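(* Let $d'\geq 4$ and $n\geq 3$ be integers with $4\mid d'$, and let $A_1,\ldots,A_n$ be $n$ nontrivial partitions of $3d'$ of the form $$A_1=[3a_{11},\ldots,3a_{1r_1}],\quad A_2=[3a_{21},\ldots,3a_{2r_2}],\quad A_3=[2a_{31},\ldots,2a_{3r_3}],$$ $$A_k=[a_{k1},\ldots,a_{kr_k}]\quad (4\leq k\leq n),$$ where all $a_{kl}\geq 1$ are integers, satisfying $\sum_{k=1}^{n}r_k=3(n-2)d'+2$. Suppose that there exists a branched cover $f:S^2\to S^2$ of degree $3d'$ with branching data $\{A_1,\ldots,A_n\}$. Then: (1) $a_{ij}\leq d'/4$ for all $1\leq i\leq n$ and $1\leq j\leq r_i$; (2) if $n\geq 4$, each partition $A_i$ with $4\leq i\leq n$ has length $r_i>12$.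
   Context: A branched cover $f:Y\to X$ between compact, connected, orientable surfaces is a surjective map that is locally modeled on the power maps $\mathbb{C}\ni z\mapsto z^m\in\mathbb{C}$ for positive integers $m$; $m$ is the local degree at the preimage point corresponding to $0$. A point of $X$ having a preimage of local degree greater than $1$ is a branch point; there are finitely many of them. Removing the branch points and their preimages gives a genuine covering map, whose degree $d$ is called the degree of $f$. A partition of $d$ is a multiset $[b_1,\ldots,b_r]$ of positive integers with sum $d$; its length is $r$, and it is nontrivial if at least one part is greater than $1$. The local degrees at the preimages of each branch point form a nontrivial partition of $d$. If $f$ has $n$ branch points, with corresponding partitions $A_1,\ldots,A_n$, then $\{A_1,\ldots,A_n\}$ (counted with multiplicity) is the branching data of $f$. *)

theory Defs
  imports "HOL-Analysis.Analysis" "HOL-Library.Multiset"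
begin

text \<open>Surfaces are sets \<open>Y\<close>, \<open>X\<close> with the subspace topology; the notions below are meant for
  compact, connected, orientable surfaces.\<close>

text \<open>\<open>f\<close> is, in charts centred at \<open>y\<close> and \<open>f y\<close>, the map \<open>z \<mapsto> z ^ m\<close> from the complex plane to itself.\<close>

definition has_local_degree ::
    "'a::topological_space set \<Rightarrow> 'b::topological_space set \<Rightarrow> ('a \<Rightarrow> 'b) \<Rightarrow> 'a \<Rightarrow> nat \<Rightarrow> bool" where
  "has_local_degree Y X f y m \<longleftrightarrow> m > 0 \<and>
     (\<exists>U V \<phi> \<phi>' \<psi> \<psi>'.
        openin (top_of_set Y) U \<and> y \<in> U \<and>
        openin (top_of_set X) V \<and> f ` U \<subseteq> V \<and>
        homeomorphism U (UNIV :: complex set) \<phi> \<phi>' \<and> \<phi> y = 0 \<and>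
        homeomorphism V (UNIV :: complex set) \<psi> \<psi>' \<and> \<psi> (f y) = 0 \<and>
        (\<forall>u\<in>U. \<psi> (f u) = \<phi> u ^ m))"

definition branched_cover ::
    "'a::topological_space set \<Rightarrow> 'b::topological_space set \<Rightarrow> ('a \<Rightarrow> 'b) \<Rightarrow> bool" where
  "branched_cover Y X f \<longleftrightarrow>
     continuous_on Y f \<and> f ` Y = X \<and> (\<forall>y\<in>Y. \<exists>m. has_local_degree Y X f y m)"

text \<open>For a branched cover the local degree is unique: it is the number of preimages near \<open>y\<close>
  of any point close to, but different from, \<open>f y\<close>.\<close>

definition local_degree ::
    "'a::topological_space set \<Rightarrow> 'b::topological_space set \<Rightarrow> ('a \<Rightarrow> 'b) \<Rightarrow> 'a \<Rightarrow> nat" where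
  "local_degree Y X f y = (THE m. has_local_degree Y X f y m)"

definition branch_points ::
    "'a::topological_space set \<Rightarrow> 'b::topological_space set \<Rightarrow> ('a \<Rightarrow> 'b) \<Rightarrow> 'b set" where
  "branch_points Y X f = {x \<in> X. \<exists>y\<in>Y. f y = x \<and> local_degree Y X f y > 1}"

text \<open>The number of sheets of the covering that remains after removing the branch points
  and their preimages.\<close>

definition has_degree ::
    "'a::topological_space set \<Rightarrow> 'b::topological_space set \<Rightarrow> ('a \<Rightarrow> 'b) \<Rightarrow> nat \<Rightarrow> bool" where
  "has_degree Y X f d \<longleftrightarrow>
     (\<forall>x \<in> X - branch_points Y X f. finite {y \<in> Y. f y = x} \<and> card {y \<in> Y. f y = x} = d)"

text \<open>By compactness, fibres and the set of branch points are finite, so \<open>mset_set\<close> does not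
  collapse to the empty multiset below.\<close>

definition fibre_partition ::
    "'a::topological_space set \<Rightarrow> 'b::topological_space set \<Rightarrow> ('a \<Rightarrow> 'b) \<Rightarrow> 'b \<Rightarrow> nat multiset" where
  "fibre_partition Y X f x = image_mset (local_degree Y X f) (mset_set {y \<in> Y. f y = x})"

definition branching_data ::
    "'a::topological_space set \<Rightarrow> 'b::topological_space set \<Rightarrow> ('a \<Rightarrow> 'b) \<Rightarrow> nat multiset multiset" where
  "branching_data Y X f = image_mset (fibre_partition Y X f) (mset_set (branch_points Y X f))"

definition is_partition :: "nat \<Rightarrow> nat multiset \<Rightarrow> bool" where
  "is_partition d P \<longleftrightarrow> (\<forall>b\<in>#P. b > 0) \<and> sum_mset P = d"

definition nontrivial_partition :: "nat \<Rightarrow> nat multiset \<Rightarrow> bool" where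
  "nontrivial_partition d P \<longleftrightarrow> is_partition d P \<and> (\<exists>b\<in>#P. b > 1)"

abbreviation S2 :: "(real ^ 3) set" where
  "S2 \<equiv> sphere 0 1"

end

theory Submission
  imports Defs "HOL-Complex_Analysis.Conformal_Mappings"
begin

text \<open>The sphere with three cone points of orders 3, 3 and 2 is the quotient of the sphere by the
  tetrahedral group, which has order 12; this quotient map \<open>tet\<close> is its orbifold universal cover.
  The divisibility hypotheses on \<open>A 1\<close>, \<open>A 2\<close> and \<open>A 3\<close> say that \<open>f\<close> is a map to this orbifold that
  can be lifted: \<open>f = tet \<circ> g\<close>, up to a change of coordinates. The map \<open>g\<close> then has degree
  \<open>3 * d' / 12 = d' / 4\<close>. Since \<open>tet\<close> absorbs the factors 3, 3, 2 and is unramified elsewhere, the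
  numbers \<open>a i j\<close> are the local degrees of \<open>g\<close>, and hence at most \<open>d' / 4\<close>. This is part (1), and
  part (2) follows from it by arithmetic.

  The lift is constructed by extracting roots, which is possible because the tetrahedral group is
  solvable: \<open>g\<close> is a linear combination of two square roots of rational functions of a cube root of
  \<open>f\<close> (lemma \<open>tet_point\<close>). Outside a finite set these functions are continuous without zeros or poles.
  As the sphere is simply connected, a continuous \<open>k\<close>-th root of such a function exists as soon as it
  exists around each puncture (lemma \<open>has_root_on_sphere\<close>), and there it exists if, in a chart, the
  function depends on the \<open>k\<close>-th power of the coordinate only (lemma \<open>invariant_has_root\<close>).

  The map \<open>g\<close> is studied outside the punctures only. In place of its local degree stands the
  statement that, in a chart, it depends on the \<open>a\<close>-th power of the coordinate only, which implies
  that it has fibres with at least \<open>a\<close> points. How this exponent behaves under extraction of roots is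
  the content of lemmas \<open>root_of_invariant_far\<close> and \<open>root_of_invariant_near\<close>. In place of the
  degree of \<open>g\<close> stands the cardinality of its generic fibres, which is constant because the generic fibres of \<open>f\<close> all have the same number of points and the plane
  without finitely many points is connected (lemma \<open>lift_fibre_bound\<close>).\<close>

section \<open>Roots on the punctured disc\<close>

lemma kth_roots_differ_by_constant:
  fixes q1 q2 :: "'a::topological_space \<Rightarrow> complex"
  assumes "connected S" "continuous_on S q1" "continuous_on S q2" "k > 0"
    and nz: "\<And>s. s \<in> S \<Longrightarrow> q2 s \<noteq> 0"
    and eq: "\<And>s. s \<in> S \<Longrightarrow> q1 s ^ k = q2 s ^ k"
  shows "\<exists>\<eta>. \<eta> ^ k = 1 \<and> (\<forall>s\<in>S. q1 s = \<eta> * q2 s)"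
proof -
  let ?Q = "\<lambda>s. q1 s / q2 s"
  have pow: "?Q s ^ k = 1" if "s \<in> S" for s
    using nz[OF that] eq[OF that] by (simp add: power_divide)
  have "continuous_on S ?Q"
    using assms by (intro continuous_intros) auto
  moreover have "finite (?Q ` S)"
  proof (rule finite_subset)
    show "?Q ` S \<subseteq> {z. z ^ k = 1}"
      using pow by auto
    show "finite {z::complex. z ^ k = 1}"
      using \<open>k > 0\<close> by (intro finite_nth_roots) auto
  qed
  ultimately have "?Q constant_on S"
    using continuous_finite_range_constant \<open>connected S\<close> by blast
  then obtain \<eta> where \<eta>: "\<And>s. s \<in> S \<Longrightarrow> ?Q s = \<eta>"
    by (auto simp: constant_on_def)
  show ?thesis
  proof (cases "S = {}")
    case True
    then show ?thesis by (auto intro: exI[of _ 1])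
  next
    case False
    then have "\<eta> ^ k = 1" using \<eta> pow by force
    moreover have "q1 s = \<eta> * q2 s" if "s \<in> S" for s
      using \<eta>[OF that] nz[OF that] by (auto simp: field_simps)
    ultimately show ?thesis by blast
  qed
qed

text \<open>The ball with centre \<open>c\<close> that touches the origin lies in an open half-plane bounded by a
  line through the origin, so a branch of the logarithm exists on it.\<close>

lemma kth_root_branch_on_ball:
  fixes c :: complex
  assumes "k > 0"
  obtains r where "continuous_on (ball c (norm c)) r" "\<And>z. z \<in> ball c (norm c) \<Longrightarrow> r z ^ k = z"
proof (cases "c = 0")
  case True
  then show ?thesis using that[of "\<lambda>_. 0"] by simp
next
  case False
  define r where "r = (\<lambda>z. exp (Ln (z / c) / of_nat k) * exp (Ln c / of_nat k))"
  have pos: "z / c \<notin> \<real>\<^sub>\<le>\<^sub>0" if "z \<in> ball c (norm c)" for z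
  proof
    assume "z / c \<in> \<real>\<^sub>\<le>\<^sub>0"
    then have "Re (z / c) \<le> 0" by (simp add: complex_nonpos_Reals_iff)
    then have "1 \<le> Re (1 - z / c)" by simp
    also have "\<dots> \<le> norm (1 - z / c)" by (rule complex_Re_le_cmod)
    also have "1 - z / c = (c - z) / c" using False by (simp add: field_simps)
    also have "norm ((c - z) / c) < 1"
      using that False by (simp add: norm_divide dist_norm)
    finally show False by simp
  qed
  have "continuous_on (ball c (norm c)) r"
    unfolding r_def using pos False assms by (intro continuous_intros) auto
  moreover have "r z ^ k = z" if "z \<in> ball c (norm c)" for z
  proof -
    have "z / c \<noteq> 0" using pos[OF that] by auto
    then show ?thesis
      using assms False by (simp add: r_def power_mult_distrib flip: exp_of_nat_mult)
  qed
  ultimately show ?thesis by (rule that)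
qed

lemma connected_punctured_disc: "connected (ball (0::complex) \<rho> - {0})"
  by (rule connected_open_diff_countable) auto

lemma unit_root_in_punctured_disc:
  fixes w \<zeta> :: complex
  assumes "\<zeta> ^ a = 1" "a > 0" "w \<in> ball 0 \<rho> - {0}"
  shows "\<zeta> * w \<in> ball 0 \<rho> - {0}"
proof -
  have "norm \<zeta> ^ a = 1" using assms(1) by (metis norm_one norm_power)
  then have "norm \<zeta> = 1" using \<open>a > 0\<close> power_eq_imp_eq_base[of "norm \<zeta>" a 1] by simp
  then show ?thesis using assms by (auto simp: norm_mult)
qed

text \<open>A function on the punctured disc has this property exactly when it depends on \<open>w ^ a\<close> only.
  This is how local degrees are tracked: it records that a map factors through a power map near a
  point, in terms of values alone, and so passes easily from a function to its roots.\<close>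

definition invariant_under_unit_roots :: "real \<Rightarrow> nat \<Rightarrow> (complex \<Rightarrow> complex) \<Rightarrow> bool" where
  "invariant_under_unit_roots \<rho> a q \<longleftrightarrow>
     (\<forall>w \<in> ball 0 \<rho> - {0}. \<forall>\<zeta>. \<zeta> ^ a = 1 \<longrightarrow> q (\<zeta> * w) = q w)"

lemma invariantD:
  "invariant_under_unit_roots \<rho> a q \<Longrightarrow> w \<in> ball 0 \<rho> - {0} \<Longrightarrow> \<zeta> ^ a = 1 \<Longrightarrow> q (\<zeta> * w) = q w"
  unfolding invariant_under_unit_roots_def by blast

text \<open>A \<open>k\<close>-th root of a function of \<open>w ^ (k * a)\<close> is a function of \<open>w ^ a\<close>. A rotation by
  \<open>\<zeta>\<close> with \<open>\<zeta> ^ a = 1\<close> is the \<open>k\<close>-th iterate of a rotation by some \<open>\<xi>\<close> under which the function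
  itself is invariant. Rotating by \<open>\<xi>\<close> therefore multiplies the root by a constant \<open>k\<close>-th root of
  unity, and doing so \<open>k\<close> times multiplies it by 1. The values may be far apart, and wind around
  the origin, in contrast to the next lemma.\<close>

lemma root_of_invariant_far:
  fixes q F :: "complex \<Rightarrow> complex"
  assumes inv: "invariant_under_unit_roots \<rho> (k * a) F"
    and cont: "continuous_on (ball 0 \<rho> - {0}) q"
    and pow: "\<And>w. w \<in> ball 0 \<rho> - {0} \<Longrightarrow> q w ^ k = F w"
    and nz: "\<And>w. w \<in> ball 0 \<rho> - {0} \<Longrightarrow> F w \<noteq> 0"
    and pos: "k > 0" "a > 0"
  shows "invariant_under_unit_roots \<rho> a q"
  unfolding invariant_under_unit_roots_def
proof (intro ballI allI impI)
  fix w \<zeta> :: complex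
  assume w: "w \<in> ball 0 \<rho> - {0}" and \<zeta>: "\<zeta> ^ a = 1"
  let ?D = "ball (0::complex) \<rho> - {0}"
  have "\<zeta> \<noteq> 0" using \<zeta> pos by (metis power_0_left zero_neq_one neq0_conv)
  define \<xi> where "\<xi> = exp (Ln \<zeta> / of_nat k)"
  have \<xi>: "\<xi> ^ k = \<zeta>"
    using pos \<open>\<zeta> \<noteq> 0\<close> by (simp add: \<xi>_def flip: exp_of_nat_mult)
  have \<xi>1: "\<xi> ^ (k * a) = 1" by (simp add: power_mult \<xi> \<zeta>)
  have \<xi>D: "\<xi> * u \<in> ?D" if "u \<in> ?D" for u
    using unit_root_in_punctured_disc[OF \<xi>1 _ that] pos by simp
  have "continuous_on ?D (\<lambda>u. q (\<xi> * u))"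
    by (rule continuous_on_compose2[OF cont]) (use \<xi>D in \<open>auto intro!: continuous_intros\<close>)
  moreover have "q (\<xi> * u) ^ k = q u ^ k" if "u \<in> ?D" for u
    using pow[OF that] pow[OF \<xi>D[OF that]] invariantD[OF inv that \<xi>1] by simp
  moreover have "q u \<noteq> 0" if "u \<in> ?D" for u
    using nz[OF that] pow[OF that] pos by (metis zero_power)
  ultimately have "\<exists>\<eta>. \<eta> ^ k = 1 \<and> (\<forall>u\<in>?D. q (\<xi> * u) = \<eta> * q u)"
    using pos by (intro kth_roots_differ_by_constant[OF connected_punctured_disc _ cont])
  then obtain \<eta> where \<eta>: "\<eta> ^ k = 1" "\<And>u. u \<in> ?D \<Longrightarrow> q (\<xi> * u) = \<eta> * q u"
    by blast
  have "\<xi> ^ j * w \<in> ?D \<and> q (\<xi> ^ j * w) = \<eta> ^ j * q w" for j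
  proof (induction j)
    case (Suc j)
    then show ?case using \<eta>(2)[of "\<xi> ^ j * w"] \<xi>D[of "\<xi> ^ j * w"] by (simp add: mult.assoc)
  qed (use w in auto)
  then have "q (\<xi> ^ k * w) = \<eta> ^ k * q w" by blast
  then show "q (\<zeta> * w) = q w" unfolding \<xi> \<eta>(1) by (simp only: mult_1_left)
qed

text \<open>If the function stays in a ball that avoids the origin, then its root is, up to a constant,
  a fixed branch composed with the function, and so no symmetry is lost.\<close>

lemma root_of_invariant_near:
  fixes q F :: "complex \<Rightarrow> complex"
  assumes inv: "invariant_under_unit_roots \<rho> a F"
    and contF: "continuous_on (ball 0 \<rho> - {0}) F"
    and cont: "continuous_on (ball 0 \<rho> - {0}) q"
    and pow: "\<And>w. w \<in> ball 0 \<rho> - {0} \<Longrightarrow> q w ^ k = F w"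
    and near: "\<And>w. w \<in> ball 0 \<rho> - {0} \<Longrightarrow> F w \<in> ball c (norm c)"
    and pos: "k > 0" "a > 0"
  shows "invariant_under_unit_roots \<rho> a q"
proof -
  let ?D = "ball (0::complex) \<rho> - {0}"
  obtain r where r: "continuous_on (ball c (norm c)) r" "\<And>z. z \<in> ball c (norm c) \<Longrightarrow> r z ^ k = z"
    using kth_root_branch_on_ball[OF \<open>k > 0\<close>] by blast
  have "continuous_on ?D (\<lambda>w. r (F w))"
    by (rule continuous_on_compose2[OF r(1) contF]) (use near in blast)
  moreover have "q w ^ k = r (F w) ^ k" if "w \<in> ?D" for w
    using pow[OF that] r(2)[OF near[OF that]] by simp
  moreover have "r (F w) \<noteq> 0" if "w \<in> ?D" for w
  proof
    assume "r (F w) = 0"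
    then have "F w = 0" using r(2)[OF near[OF that]] pos by (simp add: zero_power)
    then show False using near[OF that] by simp
  qed
  ultimately have "\<exists>\<eta>. \<eta> ^ k = 1 \<and> (\<forall>u\<in>?D. q u = \<eta> * r (F u))"
    using pos by (intro kth_roots_differ_by_constant[OF connected_punctured_disc cont])
  then obtain \<eta> where \<eta>: "\<And>u. u \<in> ?D \<Longrightarrow> q u = \<eta> * r (F u)"
    by blast
  show ?thesis
    unfolding invariant_under_unit_roots_def
  proof (intro ballI allI impI)
    fix w \<zeta> :: complex
    assume w: "w \<in> ?D" "\<zeta> ^ a = 1"
    have mem: "\<zeta> * w \<in> ?D" by (rule unit_root_in_punctured_disc[OF w(2) \<open>a > 0\<close> w(1)])
    show "q (\<zeta> * w) = q w"
      by (simp only: \<eta>[OF w(1)] \<eta>[OF mem] invariantD[OF inv w])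
  qed
qed

text \<open>On the half-plane that covers the punctured disc under \<open>exp\<close> the function has a logarithm
  \<open>L\<close>. Translation by one \<open>k\<close>-th of the period changes \<open>exp (L / k)\<close> by a constant \<open>k\<close>-th root of
  unity, so translation by the full period does not change it, and the root descends to the disc.\<close>

lemma invariant_has_root:
  fixes F :: "complex \<Rightarrow> complex"
  assumes inv: "invariant_under_unit_roots \<rho> k F"
    and cont: "continuous_on (ball 0 \<rho> - {0}) F"
    and nz: "\<And>w. w \<in> ball 0 \<rho> - {0} \<Longrightarrow> F w \<noteq> 0"
    and pos: "k > 0" "\<rho> > 0"
  obtains q where "continuous_on (ball 0 \<rho> - {0}) q" "\<And>w. w \<in> ball 0 \<rho> - {0} \<Longrightarrow> q w ^ k = F w"
proof -
  let ?D = "ball (0::complex) \<rho> - {0}"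
  define H where "H = {u::complex. Re u < ln \<rho>}"
  have H_exp: "exp u \<in> ?D \<longleftrightarrow> u \<in> H" for u
    using pos by (simp add: H_def ln_less_cancel_iff[symmetric] del: ln_less_cancel_iff)
  have convH: "convex H" unfolding H_def by (rule convex_halfspace_Re_lt)
  have "continuous_on H (\<lambda>u. F (exp u))"
    by (rule continuous_on_compose2[OF cont]) (use H_exp in \<open>auto intro!: continuous_intros\<close>)
  then obtain L where L: "continuous_on H L" "\<And>u. u \<in> H \<Longrightarrow> F (exp u) = exp (L u)"
    using continuous_logarithm_on_contractible[OF _ convex_imp_contractible[OF convH]] nz H_exp by metis
  define T where "T = (\<lambda>j. 2 * of_nat j * of_real pi * \<i> / of_nat k)"
  have TH: "u + T j \<in> H \<longleftrightarrow> u \<in> H" for u j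
    by (simp add: H_def T_def)
  let ?E = "\<lambda>u. exp (L u / of_nat k)"
  have expT: "exp (T 1) ^ k = 1"
    using pos by (simp add: T_def flip: exp_of_nat_mult)
  have step: "exp (L (u + T 1)) = exp (L u)" if "u \<in> H" for u
  proof -
    have "exp (u + T 1) = exp (T 1) * exp u" by (simp only: exp_add mult.commute)
    then have "F (exp (u + T 1)) = F (exp u)"
      using invariantD[OF inv _ expT, of "exp u"] that H_exp by metis
    then show ?thesis using L(2) TH that by metis
  qed
  have "continuous_on H (\<lambda>u. ?E (u + T 1))"
    by (intro continuous_intros continuous_on_compose2[OF L(1)]) (use TH pos in auto)
  moreover have contE: "continuous_on H ?E"
    by (intro continuous_intros L(1)) (use pos in auto)
  moreover have "?E (u + T 1) ^ k = ?E u ^ k" if "u \<in> H" for u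
    using step[OF that] pos by (simp flip: exp_of_nat_mult)
  ultimately have "\<exists>\<eta>. \<eta> ^ k = 1 \<and> (\<forall>u\<in>H. ?E (u + T 1) = \<eta> * ?E u)"
    using pos by (intro kth_roots_differ_by_constant[OF convex_connected[OF convH]]) simp_all
  then obtain \<eta> where \<eta>: "\<eta> ^ k = 1" "\<And>u. u \<in> H \<Longrightarrow> ?E (u + T 1) = \<eta> * ?E u"
    by blast
  have ET: "?E (u + T j) = \<eta> ^ j * ?E u" if "u \<in> H" for u j
  proof (induction j)
    case 0
    then show ?case by (simp add: T_def)
  next
    case (Suc j)
    have "u + T (Suc j) = (u + T j) + T 1" by (simp add: T_def ring_distribs add_divide_distrib)
    moreover have "?E (u + T j + T 1) = \<eta> * ?E (u + T j)" using \<eta>(2) TH that by blast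
    ultimately show ?case using Suc by (simp add: add.assoc mult.assoc)
  qed
  have Tk: "T k = 2 * of_real pi * \<i>" using pos by (simp add: T_def)
  have per: "?E (u + 2 * of_real pi * \<i>) = ?E u" if "u \<in> H" for u
    using ET[OF that, of k] unfolding Tk \<eta>(1) by (simp only: mult_1_left)
  define q where "q = (\<lambda>w. ?E (Ln w))"
  have LnH: "Ln w \<in> H" if "w \<in> ?D" for w
    using H_exp[of "Ln w"] that by simp
  have "q w ^ k = F w" if "w \<in> ?D" for w
    using that L(2)[OF LnH[OF that]] pos by (simp add: q_def flip: exp_of_nat_mult)
  moreover have "continuous_on ?D q"
  proof -
    have 1: "continuous_on (?D - \<real>\<^sub>\<le>\<^sub>0) q"
      unfolding q_def
    proof (rule continuous_on_compose2[OF contE])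
      show "continuous_on (?D - \<real>\<^sub>\<le>\<^sub>0) Ln" by (auto intro!: continuous_intros)
    qed (use LnH in blast)
    \<comment> \<open>across the cut of \<open>Ln\<close> the root is given by the other branch, which differs by a period\<close>
    have q': "q w = ?E (Ln (- w) + of_real pi * \<i>)" if w: "w \<in> ?D" for w
    proof -
      have "Ln (- w) + of_real pi * \<i> = Ln w \<or> Ln (- w) + of_real pi * \<i> = Ln w + 2 * of_real pi * \<i>"
        using w Ln_minus[of w] by (cases "Im w \<le> 0 \<and> \<not> (Re w < 0 \<and> Im w = 0)") (simp_all add: algebra_simps)
      then show ?thesis
        by (rule disjE) (simp_all only: q_def per[OF LnH[OF w]])
    qed
    have "continuous_on (?D - \<real>\<^sub>\<ge>\<^sub>0) (\<lambda>w. ?E (Ln (- w) + of_real pi * \<i>))"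
    proof (rule continuous_on_compose2[OF contE])
      show "continuous_on (?D - \<real>\<^sub>\<ge>\<^sub>0) (\<lambda>w. Ln (- w) + of_real pi * \<i>)"
        by (auto intro!: continuous_intros)
      have "Ln (- w) + of_real pi * \<i> \<in> H" if "w \<in> ?D" for w
        using LnH[of "- w"] that by (auto simp: H_def)
      then show "(\<lambda>w. Ln (- w) + of_real pi * \<i>) ` (?D - \<real>\<^sub>\<ge>\<^sub>0) \<subseteq> H" by blast
    qed
    then have 2: "continuous_on (?D - \<real>\<^sub>\<ge>\<^sub>0) q"
      by (rule continuous_on_eq) (use q' in auto)
    have "?D = (?D - \<real>\<^sub>\<le>\<^sub>0) \<union> (?D - \<real>\<^sub>\<ge>\<^sub>0)"
      by (auto simp: complex_nonpos_Reals_iff complex_nonneg_Reals_iff complex_eq_iff)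
    moreover have "open (?D - \<real>\<^sub>\<le>\<^sub>0)" "open (?D - \<real>\<^sub>\<ge>\<^sub>0)"
      by (auto intro!: open_Diff)
    ultimately show ?thesis
      using continuous_on_open_Un[OF _ _ 1 2] by simp
  qed
  ultimately show thesis using that by blast
qed

section \<open>Gluing roots in the plane\<close>

definition has_root_on :: "nat \<Rightarrow> ('a::topological_space \<Rightarrow> complex) \<Rightarrow> 'a set \<Rightarrow> bool" where
  "has_root_on k F S \<longleftrightarrow> (\<exists>q. continuous_on S q \<and> (\<forall>x\<in>S. q x ^ k = F x))"

lemma has_root_on_subset: "has_root_on k F S \<Longrightarrow> T \<subseteq> S \<Longrightarrow> has_root_on k F T"
  unfolding has_root_on_def by (meson continuous_on_subset subsetD)

text \<open>On the connected overlap the two roots differ by a constant, which can be absorbed into one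
  of them.\<close>

lemma has_root_on_Un:
  fixes F :: "'a::topological_space \<Rightarrow> complex"
  assumes A: "has_root_on k F A" "openin (top_of_set (A \<union> B)) A"
    and B: "has_root_on k F B" "openin (top_of_set (A \<union> B)) B"
    and conn: "connected (A \<inter> B)" and nz: "\<And>x. x \<in> A \<inter> B \<Longrightarrow> F x \<noteq> 0" and "k > 0"
  shows "has_root_on k F (A \<union> B)"
proof -
  obtain p where p: "continuous_on A p" "\<And>x. x \<in> A \<Longrightarrow> p x ^ k = F x"
    using A(1) unfolding has_root_on_def by blast
  obtain q where q: "continuous_on B q" "\<And>x. x \<in> B \<Longrightarrow> q x ^ k = F x"
    using B(1) unfolding has_root_on_def by blast
  have "\<exists>\<eta>. \<eta> ^ k = 1 \<and> (\<forall>x\<in>A \<inter> B. p x = \<eta> * q x)"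
  proof (rule kth_roots_differ_by_constant[OF conn])
    show "continuous_on (A \<inter> B) p" "continuous_on (A \<inter> B) q"
      using p(1) q(1) by (auto intro: continuous_on_subset)
    show "q x \<noteq> 0" if "x \<in> A \<inter> B" for x
      using nz[OF that] q(2)[of x] that \<open>k > 0\<close> by (auto simp: zero_power)
    show "p x ^ k = q x ^ k" if "x \<in> A \<inter> B" for x
      using p(2)[of x] q(2)[of x] that by simp
  qed (use \<open>k > 0\<close> in simp)
  then obtain \<eta> where \<eta>: "\<eta> ^ k = 1" "\<And>x. x \<in> A \<inter> B \<Longrightarrow> p x = \<eta> * q x"
    by blast
  define g where "g = (\<lambda>x. if x \<in> A then p x else \<eta> * q x)"
  have "continuous_on (A \<union> B) g"
    unfolding g_def
    by (rule continuous_on_cases_local_open[OF A(2) B(2) p(1)])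
       (use \<eta> q(1) in \<open>auto intro!: continuous_intros\<close>)
  moreover have "g x ^ k = F x" if "x \<in> A \<union> B" for x
    using that p(2) q(2) \<eta>(1) by (auto simp: g_def power_mult_distrib)
  ultimately show ?thesis unfolding has_root_on_def by blast
qed

definition rect :: "real \<Rightarrow> real \<Rightarrow> real \<Rightarrow> real \<Rightarrow> complex set" where
  "rect a b c d = {z. a < Re z \<and> Re z < b \<and> c < Im z \<and> Im z < d}"

lemma open_rect: "open (rect a b c d)"
  unfolding rect_def by (intro open_Collect_conj open_Collect_less continuous_intros)

lemma connected_rect: "connected (rect a b c d)"
proof -
  have "rect a b c d = {z. Re z > a} \<inter> {z. Re z < b} \<inter> {z. Im z > c} \<inter> {z. Im z < d}"
    by (auto simp: rect_def)
  then show ?thesis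
    by (auto intro!: convex_connected convex_Int convex_halfspace_Re_gt convex_halfspace_Re_lt
        convex_halfspace_Im_gt convex_halfspace_Im_lt)
qed

text \<open>Open rectangles are built up from small ones by bisection, first in the vertical and then in
  the horizontal direction. Two neighbouring rectangles overlap in a rectangle, and this stays
  connected when finitely many points are removed; so the gluing lemma applies.\<close>

lemma has_root_on_rect:
  fixes F :: "complex \<Rightarrow> complex"
  assumes local: "\<And>z. \<exists>W. open W \<and> z \<in> W \<and> has_root_on k F (W - P)"
    and nz: "\<And>z. z \<notin> P \<Longrightarrow> F z \<noteq> 0" and "finite P" "k > 0"
  shows "has_root_on k F (rect a b c d - P)"
proof -
  let ?L = "\<lambda>S. has_root_on k F (S - P)"
  have L_mono: "?L T" if "?L S" "T \<subseteq> S" for S T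
    using that by (auto intro: has_root_on_subset)
  have glue: "?L (S \<union> T)" if "open S" "open T" "connected (S \<inter> T)" "?L S" "?L T" for S T
  proof -
    have "has_root_on k F ((S - P) \<union> (T - P))"
    proof (rule has_root_on_Un)
      have "closed P" using \<open>finite P\<close> by (rule finite_imp_closed)
      then show "openin (top_of_set ((S - P) \<union> (T - P))) (S - P)"
        "openin (top_of_set ((S - P) \<union> (T - P))) (T - P)"
        using that by (auto intro!: open_subset open_Diff)
      have "(S - P) \<inter> (T - P) = S \<inter> T - P" by blast
      then show "connected ((S - P) \<inter> (T - P))"
        using connected_open_diff_countable[of "S \<inter> T" P] that \<open>finite P\<close>
        by (simp add: open_Int countable_finite)
    qed (use that nz \<open>k > 0\<close> in auto)
    then show ?thesis by (simp add: Un_Diff)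
  qed
  have strip: "\<exists>\<epsilon>>0. ?L (rect (s - \<epsilon>) (s + \<epsilon>) (c - \<epsilon>) (d + \<epsilon>))" if "c \<le> d" for s c d
    using that
  proof (induction rule: Bolzano[consumes 1])
    case (trans c m d)
    then obtain \<epsilon>1 \<epsilon>2 where \<epsilon>: "\<epsilon>1 > 0" "?L (rect (s - \<epsilon>1) (s + \<epsilon>1) (c - \<epsilon>1) (m + \<epsilon>1))"
      "\<epsilon>2 > 0" "?L (rect (s - \<epsilon>2) (s + \<epsilon>2) (m - \<epsilon>2) (d + \<epsilon>2))"
      by blast
    define \<epsilon> where "\<epsilon> = min \<epsilon>1 \<epsilon>2"
    let ?A = "rect (s - \<epsilon>) (s + \<epsilon>) (c - \<epsilon>) (m + \<epsilon>)" and ?B = "rect (s - \<epsilon>) (s + \<epsilon>) (m - \<epsilon>) (d + \<epsilon>)"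
    have "\<epsilon> > 0" using \<epsilon> by (simp add: \<epsilon>_def)
    have "?L ?A" by (rule L_mono[OF \<epsilon>(2)]) (auto simp: rect_def \<epsilon>_def)
    moreover have "?L ?B" by (rule L_mono[OF \<epsilon>(4)]) (auto simp: rect_def \<epsilon>_def)
    moreover have "?A \<inter> ?B = rect (s - \<epsilon>) (s + \<epsilon>) (m - \<epsilon>) (m + \<epsilon>)"
      using trans by (auto simp: rect_def)
    ultimately have "?L (?A \<union> ?B)"
      by (intro glue open_rect) (simp_all add: connected_rect)
    moreover have "?A \<union> ?B = rect (s - \<epsilon>) (s + \<epsilon>) (c - \<epsilon>) (d + \<epsilon>)"
      using trans \<open>\<epsilon> > 0\<close> by (auto simp: rect_def)
    ultimately show ?case using \<open>\<epsilon> > 0\<close> by auto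
  next
    case (local t)
    obtain W where W: "open W" "Complex s t \<in> W" "?L W" using assms(1) by blast
    then obtain e where e: "e > 0" "ball (Complex s t) e \<subseteq> W" using open_contains_ball by blast
    show ?case
    proof (rule exI[of _ "e / 4"], intro conjI allI impI)
      fix c d assume cd: "c \<le> t \<and> t \<le> d \<and> d - c < e / 4"
      have "rect (s - e / 4) (s + e / 4) (c - e / 4) (d + e / 4) \<subseteq> ball (Complex s t) e"
      proof
        fix z assume "z \<in> rect (s - e / 4) (s + e / 4) (c - e / 4) (d + e / 4)"
        then have "\<bar>Re z - s\<bar> < e / 4" "\<bar>Im z - t\<bar> < e / 2"
          using cd unfolding rect_def mem_Collect_eq abs_less_iff by linarith+
        then show "z \<in> ball (Complex s t) e"
          using cmod_le[of "z - Complex s t"] e(1) by (simp add: dist_norm norm_minus_commute)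
      qed
      then show "\<exists>\<epsilon>>0. ?L (rect (s - \<epsilon>) (s + \<epsilon>) (c - \<epsilon>) (d + \<epsilon>))"
        using e by (intro exI[of _ "e / 4"] conjI L_mono[OF W(3)]) auto
    qed (use e in auto)
  qed
  have block: "\<exists>\<epsilon>>0. ?L (rect (a - \<epsilon>) (b + \<epsilon>) c d)" if "a \<le> b" "c \<le> d" for a b
    using that(1)
  proof (induction rule: Bolzano[consumes 1])
    case (trans a m b)
    then obtain \<epsilon>1 \<epsilon>2 where \<epsilon>: "\<epsilon>1 > 0" "?L (rect (a - \<epsilon>1) (m + \<epsilon>1) c d)"
      "\<epsilon>2 > 0" "?L (rect (m - \<epsilon>2) (b + \<epsilon>2) c d)"
      by blast
    define \<epsilon> where "\<epsilon> = min \<epsilon>1 \<epsilon>2"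
    let ?A = "rect (a - \<epsilon>) (m + \<epsilon>) c d" and ?B = "rect (m - \<epsilon>) (b + \<epsilon>) c d"
    have "\<epsilon> > 0" using \<epsilon> by (simp add: \<epsilon>_def)
    have "?L ?A" by (rule L_mono[OF \<epsilon>(2)]) (auto simp: rect_def \<epsilon>_def)
    moreover have "?L ?B" by (rule L_mono[OF \<epsilon>(4)]) (auto simp: rect_def \<epsilon>_def)
    moreover have "?A \<inter> ?B = rect (m - \<epsilon>) (m + \<epsilon>) c d"
      using trans by (auto simp: rect_def)
    ultimately have "?L (?A \<union> ?B)"
      by (intro glue open_rect) (simp_all add: connected_rect)
    moreover have "?A \<union> ?B = rect (a - \<epsilon>) (b + \<epsilon>) c d"
      using trans \<open>\<epsilon> > 0\<close> by (auto simp: rect_def)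
    ultimately show ?case using \<open>\<epsilon> > 0\<close> by auto
  next
    case (local s)
    obtain e where e: "e > 0" "?L (rect (s - e) (s + e) (c - e) (d + e))"
      using strip[OF \<open>c \<le> d\<close>] by blast
    show ?case
    proof (rule exI[of _ "e / 2"], intro conjI allI impI)
      fix a b assume ab: "a \<le> s \<and> s \<le> b \<and> b - a < e / 2"
      show "\<exists>\<epsilon>>0. ?L (rect (a - \<epsilon>) (b + \<epsilon>) c d)"
        using e(1) ab by (intro exI[of _ "e / 2"] conjI L_mono[OF e(2)]) (auto simp: rect_def)
    qed (use e in auto)
  qed
  show ?thesis
  proof (cases "a \<le> b \<and> c \<le> d")
    case True
    then obtain \<epsilon> where "\<epsilon> > 0" "?L (rect (a - \<epsilon>) (b + \<epsilon>) c d)" using block by blast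
    then show ?thesis by (auto intro: L_mono simp: rect_def)
  next
    case False
    then have "rect a b c d = {}" by (auto simp: rect_def)
    then show ?thesis by (auto simp: has_root_on_def)
  qed
qed

section \<open>Roots on the punctured sphere\<close>

lemma sphere_minus_point_plane:
  fixes b :: "real ^ 3"
  assumes "b \<in> S2"
  obtains \<sigma> \<tau> where "homeomorphism (S2 - {b}) (UNIV :: complex set) \<sigma> \<tau>"
proof -
  have "sphere (0::real^3) 1 \<inter> UNIV - {b} homeomorphic (UNIV :: complex set)"
    by (rule homeomorphic_punctured_affine_sphere_affine) (use assms in auto)
  then show thesis using that by (auto simp: homeomorphic_def)
qed

lemma openin_sphere_complement_compact:
  assumes "compact K" shows "openin (top_of_set S2) (S2 - K)"
proof -
  have "S2 - K = S2 \<inter> - K" by blast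
  then show ?thesis using assms by (metis compact_imp_closed open_Compl openin_open_Int)
qed

text \<open>This is where the sphere being simply connected enters: a \<open>k\<close>-th root that exists locally,
  also around the punctures, exists globally. A large disc in the plane obtained by removing a point
  \<open>b\<close> is covered by the result on rectangles, a neighbourhood of \<open>b\<close> by the hypothesis, and the two
  can be chosen to overlap in an annulus.\<close>

lemma has_root_on_sphere:
  fixes F :: "real ^ 3 \<Rightarrow> complex"
  assumes local: "\<And>y. y \<in> S2 \<Longrightarrow> \<exists>W. openin (top_of_set S2) W \<and> y \<in> W \<and> has_root_on k F (W - P)"
    and nz: "\<And>y. y \<in> S2 - P \<Longrightarrow> F y \<noteq> 0" and "finite P" "k > 0"
  shows "has_root_on k F (S2 - P)"
proof -
  obtain b :: "real ^ 3" where b: "b \<in> S2"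
    using vector_choose_size[of 1] by (auto simp: dist_norm)
  obtain \<sigma> \<tau> where hom: "homeomorphism (S2 - {b}) (UNIV :: complex set) \<sigma> \<tau>"
    using sphere_minus_point_plane[OF b] by blast
  have \<tau>: "continuous_on UNIV \<tau>" "range \<tau> = S2 - {b}" "\<And>z. \<sigma> (\<tau> z) = z" "\<And>y. y \<in> S2 - {b} \<Longrightarrow> \<tau> (\<sigma> y) = y"
    and \<sigma>: "continuous_on (S2 - {b}) \<sigma>"
    using hom by (auto simp: homeomorphism_def)
  have \<tau>S: "\<tau> z \<in> S2 - {b}" for z using \<tau>(2) by blast
  have \<tau>_open: "openin (top_of_set S2) (\<tau> ` V)" if "open V" for V
  proof -
    have "openin (top_of_set (S2 - {b})) (\<tau> ` V)"
      using homeomorphism_imp_open_map[OF homeomorphism_symD[OF hom]] that by simp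
    moreover have "openin (top_of_set S2) (S2 - {b})"
      by (rule openin_sphere_complement_compact) simp
    ultimately show ?thesis by (rule openin_trans)
  qed
  have inj: "inj \<tau>" using \<tau>(3) by (metis injI)
  define Q where "Q = \<tau> -` P"
  have Q: "finite Q" using \<open>finite P\<close> inj by (simp add: Q_def finite_vimageI)
  have PQ: "\<tau> z \<notin> P" if "z \<notin> Q" for z
    using that by (simp add: Q_def)
  have plane: "has_root_on k (F \<circ> \<tau>) (rect a b c d - Q)" for a b c d
  proof (rule has_root_on_rect[OF _ _ Q \<open>k > 0\<close>])
    show "(F \<circ> \<tau>) z \<noteq> 0" if "z \<notin> Q" for z
      using nz[of "\<tau> z"] PQ[OF that] \<tau>S[of z] by simp
    fix z
    have "\<tau> z \<in> S2" using \<tau>S by blast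
    then obtain W where W: "openin (top_of_set S2) W" "\<tau> z \<in> W" "has_root_on k F (W - P)"
      using local by blast
    then obtain T q where T: "open T" "W = S2 \<inter> T" and q: "continuous_on (W - P) q" "\<And>y. y \<in> W - P \<Longrightarrow> q y ^ k = F y"
      by (auto simp: openin_open has_root_on_def)
    have sub: "\<tau> ` (\<tau> -` T - Q) \<subseteq> W - P"
      using \<tau>(2) T PQ by auto
    have "continuous_on (\<tau> -` T - Q) (q \<circ> \<tau>)"
      using sub by (intro continuous_on_compose continuous_on_subset[OF \<tau>(1)] continuous_on_subset[OF q(1)]) auto
    moreover have "(q \<circ> \<tau>) u ^ k = (F \<circ> \<tau>) u" if "u \<in> \<tau> -` T - Q" for u
      using q(2)[of "\<tau> u"] sub that by auto
    ultimately have "has_root_on k (F \<circ> \<tau>) (\<tau> -` T - Q)"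
      unfolding has_root_on_def by blast
    moreover have "open (\<tau> -` T)"
      using \<tau>(1) T(1) by (simp add: continuous_on_open_vimage)
    ultimately show "\<exists>W. open W \<and> z \<in> W \<and> has_root_on k (F \<circ> \<tau>) (W - Q)"
      using W T by (intro exI[of _ "\<tau> -` T"]) auto
  qed
  obtain W where W: "openin (top_of_set S2) W" "b \<in> W" "has_root_on k F (W - P)"
    using local[OF b] by blast
  obtain T where T: "open T" "W = S2 \<inter> T" using W(1) by (auto simp: openin_open)
  have "compact (S2 - T)" using T(1) by (intro compact_diff) auto
  then have "compact (\<sigma> ` (S2 - T))"
    using \<sigma> W T by (intro compact_continuous_image continuous_on_subset[OF \<sigma>]) auto
  then obtain R where R: "\<And>z. z \<in> \<sigma> ` (S2 - T) \<Longrightarrow> norm z \<le> R"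
    using compact_imp_bounded bounded_iff by metis
  let ?A = "\<tau> ` ball 0 (R + 1)" and ?B = "S2 - \<tau> ` cball 0 R"
  have AB: "?A \<union> ?B = S2"
  proof -
    have "\<tau> ` cball 0 R \<subseteq> ?A" by (intro image_mono) auto
    then show ?thesis using \<tau>(2) by blast
  qed
  have "has_root_on k F ((?A - P) \<union> (?B - P))"
  proof (rule has_root_on_Un)
    have rel: "openin (top_of_set ((?A - P) \<union> (?B - P))) (U - P)" if "openin (top_of_set S2) U" for U
    proof -
      have "(?A - P) \<union> (?B - P) = S2 - P" using AB by blast
      then show ?thesis using that by (auto simp: openin_open)
    qed
    show "openin (top_of_set ((?A - P) \<union> (?B - P))) (?A - P)"
      by (intro rel \<tau>_open) simp
    show "openin (top_of_set ((?A - P) \<union> (?B - P))) (?B - P)"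
      by (intro rel openin_sphere_complement_compact compact_continuous_image
          continuous_on_subset[OF \<tau>(1)]) auto
    show "has_root_on k F (?B - P)"
    proof (rule has_root_on_subset[OF W(3)])
      show "?B - P \<subseteq> W - P"
      proof
        fix y assume y: "y \<in> ?B - P"
        have "y \<in> W"
        proof (rule ccontr)
          assume "y \<notin> W"
          then have "y \<in> S2 - T" "y \<noteq> b" using y T W by auto
          then have "y = \<tau> (\<sigma> y)" "norm (\<sigma> y) \<le> R" using \<tau>(4) R by auto
          then show False using y by (auto simp: image_iff)
        qed
        then show "y \<in> W - P" using y by blast
      qed
    qed
    show "has_root_on k F (?A - P)"
    proof -
      obtain q where q: "continuous_on (rect (-(R+1)) (R+1) (-(R+1)) (R+1) - Q) q"
        "\<And>z. z \<in> rect (-(R+1)) (R+1) (-(R+1)) (R+1) - Q \<Longrightarrow> q z ^ k = F (\<tau> z)"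
        using plane[of "-(R+1)" "R+1" "-(R+1)" "R+1"] unfolding has_root_on_def o_apply by blast
      have ball: "ball 0 (R+1) \<subseteq> rect (-(R+1)) (R+1) (-(R+1)) (R+1)"
      proof
        fix z :: complex assume "z \<in> ball 0 (R+1)"
        then have "norm z < R + 1" by simp
        then show "z \<in> rect (-(R+1)) (R+1) (-(R+1)) (R+1)"
          using abs_Re_le_cmod[of z] abs_Im_le_cmod[of z] by (auto simp: rect_def)
      qed
      have \<sigma>A: "\<sigma> y \<in> rect (-(R+1)) (R+1) (-(R+1)) (R+1) - Q \<and> y \<in> S2 - {b}" if yA: "y \<in> ?A - P" for y
      proof -
        obtain z where z: "z \<in> ball 0 (R+1)" "y = \<tau> z" using yA by blast
        have "z \<notin> Q" using yA z(2) by (simp add: Q_def)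
        then show ?thesis using z ball \<tau>(3) \<tau>S[of z] by auto
      qed
      have "continuous_on (?A - P) (\<lambda>y. q (\<sigma> y))"
        by (rule continuous_on_compose2[OF q(1) continuous_on_subset[OF \<sigma>]]) (use \<sigma>A in blast)+
      moreover have "q (\<sigma> y) ^ k = F y" if "y \<in> ?A - P" for y
        using q(2)[of "\<sigma> y"] \<sigma>A[OF that] \<tau>(4) by simp
      ultimately show ?thesis unfolding has_root_on_def by blast
    qed
    show "connected ((?A - P) \<inter> (?B - P))"
    proof -
      let ?N = "{z. R < norm (z - 0) \<and> norm (z - 0) < R + 1} :: complex set"
      have "open ?N" by (intro open_Collect_conj open_Collect_less continuous_intros)
      then have "connected (?N - Q)"
        by (intro connected_open_diff_countable connected_annulus countable_finite Q) auto
      then have "connected (\<tau> ` (?N - Q))"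
        by (intro connected_continuous_image continuous_on_subset[OF \<tau>(1)]) auto
      also have "\<tau> ` (?N - Q) = (?A - P) \<inter> (?B - P)"
        using \<tau>(2) inj by (auto simp: inj_eq Q_def inj_image_mem_iff)
      finally show ?thesis .
    qed
  qed (use nz \<open>k > 0\<close> AB in auto)
  moreover have "(?A - P) \<union> (?B - P) = S2 - P" using AB by blast
  ultimately show ?thesis by simp
qed

section \<open>Charts and the local degree\<close>

text \<open>Of the two charts in the definition of the local degree only the inverse \<open>e\<close> of the one in
  the source is kept: that \<open>f\<close> is the power map means that the fibres of \<open>f \<circ> e\<close> are those of the
  power map, and that \<open>f\<close> is open at \<open>y\<close>.\<close>

lemma local_degree_chart:
  assumes "has_local_degree Y X f y m"
  obtains e :: "complex \<Rightarrow> 'a::topological_space" and e'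
  where "homeomorphism UNIV (range e) e e'" "e 0 = y" "range e \<subseteq> Y" "m > 0"
    "\<And>w w'. f (e w) = f (e w') \<longleftrightarrow> w ^ m = w' ^ m"
    "\<And>V. open V \<Longrightarrow> openin (top_of_set Y) (e ` V)"
    "\<And>V. open V \<Longrightarrow> 0 \<in> V \<Longrightarrow> \<exists>T. openin (top_of_set X) T \<and> f y \<in> T \<and> T \<subseteq> f ` e ` V"
proof -
  obtain U V \<phi> e \<psi> \<psi>' where U: "openin (top_of_set Y) U" "y \<in> U" and V: "openin (top_of_set X) V" "f ` U \<subseteq> V"
    and \<phi>: "homeomorphism U (UNIV :: complex set) \<phi> e" "\<phi> y = 0"
    and \<psi>: "homeomorphism V (UNIV :: complex set) \<psi> \<psi>'" "\<psi> (f y) = 0"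
    and pow: "\<And>u. u \<in> U \<Longrightarrow> \<psi> (f u) = \<phi> u ^ m" and m: "m > 0"
    using assms unfolding has_local_degree_def by blast
  have e: "continuous_on UNIV e" "range e = U" "\<And>z. \<phi> (e z) = z" "e 0 = y"
    using \<phi> U by (auto simp: homeomorphism_def)
  have \<psi>': "\<And>v. v \<in> V \<Longrightarrow> \<psi>' (\<psi> v) = v" "\<And>z. \<psi> (\<psi>' z) = z" "range \<psi>' = V"
    using \<psi> by (auto simp: homeomorphism_def)
  have eU: "e w \<in> U" and fV: "f (e w) \<in> V" and fe: "\<psi> (f (e w)) = w ^ m" for w
    using e(2) V(2) pow[of "e w"] e(3) by auto
  show thesis
  proof (rule that[of e \<phi>])
    show "e 0 = y" "m > 0" by fact+
    show "homeomorphism UNIV (range e) e \<phi>" using homeomorphism_symD[OF \<phi>(1)] e(2) by simp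
    show "range e \<subseteq> Y" using e(2) openin_imp_subset[OF U(1)] by simp
    show "f (e w) = f (e w') \<longleftrightarrow> w ^ m = w' ^ m" for w w'
      using fe fV \<psi>'(1) by metis
    show "openin (top_of_set Y) (e ` S)" if "open S" for S
      using homeomorphism_imp_open_map[OF homeomorphism_symD[OF \<phi>(1)]] that U(1) openin_trans by auto
    fix S :: "complex set" assume "open S" "0 \<in> S"
    then obtain \<rho> where \<rho>: "\<rho> > 0" "ball 0 \<rho> \<subseteq> S" using open_contains_ball by blast
    show "\<exists>T. openin (top_of_set X) T \<and> f y \<in> T \<and> T \<subseteq> f ` e ` S"
    proof (intro exI conjI)
      show "openin (top_of_set X) (\<psi>' ` ball 0 (\<rho> ^ m))"
        using homeomorphism_imp_open_map[OF homeomorphism_symD[OF \<psi>(1)], of "ball 0 (\<rho> ^ m)"] V(1) openin_trans by auto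
      have "\<psi>' 0 = f y" using \<psi>(2) \<psi>'(1)[of "f y"] U V by auto
      then show "f y \<in> \<psi>' ` ball 0 (\<rho> ^ m)" using \<rho> by (auto simp: image_iff intro!: bexI[of _ 0])
      show "\<psi>' ` ball 0 (\<rho> ^ m) \<subseteq> f ` e ` S"
      proof
        fix v assume "v \<in> \<psi>' ` ball 0 (\<rho> ^ m)"
        then obtain z where z: "v = \<psi>' z" "norm z < \<rho> ^ m" by auto
        define w where "w = (if z = 0 then 0 else exp (Ln z / of_nat m))"
        have w: "w ^ m = z" using m by (auto simp: w_def zero_power simp flip: exp_of_nat_mult)
        then have "norm w ^ m < \<rho> ^ m" using z(2) by (metis norm_power)
        then have "norm w < \<rho>" using \<rho>(1) by (meson less_eq_real_def power_less_imp_less_base)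
        moreover have "f (e w) = v" using fe[of w] w z(1) \<psi>'(1)[OF fV] by metis
        ultimately show "v \<in> f ` e ` S" using \<rho>(2) by (force simp: dist_norm)
      qed
    qed
  qed
qed

text \<open>Close to the centre, \<open>m\<close> distinct points of one chart with the same image under \<open>f\<close> lie in the
  other chart, where a fibre away from the centre has only \<open>n\<close> points.\<close>

lemma local_degree_le:
  fixes m n :: nat
  assumes "has_local_degree Y X f y m" "has_local_degree Y X f y n"
  shows "m \<le> n"
proof -
  obtain e :: "complex \<Rightarrow> 'a" and i where e0: "homeomorphism UNIV (range e) e i" "e 0 = y" "range e \<subseteq> Y" "m > 0"
    "\<And>w w'. f (e w) = f (e w') \<longleftrightarrow> w ^ m = w' ^ m"
    using local_degree_chart[OF assms(1)] by metis
  then have e: "continuous_on UNIV e" "inj e" "e 0 = y" "range e \<subseteq> Y" "m > 0"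
    "\<And>w w'. f (e w) = f (e w') \<longleftrightarrow> w ^ m = w' ^ m"
    by (auto simp: homeomorphism_def intro: inj_on_inverseI)
  obtain e' :: "complex \<Rightarrow> 'a" and i' where "homeomorphism UNIV (range e') e' i'" and e'': "e' 0 = y" "n > 0"
    "\<And>w w'. f (e' w) = f (e' w') \<longleftrightarrow> w ^ n = w' ^ n"
    "\<And>V. open V \<Longrightarrow> openin (top_of_set Y) (e' ` V)"
    using local_degree_chart[OF assms(2)] by metis
  then have "inj e'" by (auto simp: homeomorphism_def intro: inj_on_inverseI)
  note e' = this e''
  obtain T where T: "open T" "range e' = Y \<inter> T"
    using e'(5)[of UNIV] by (auto simp: openin_open)
  have "open (e -` T)" using e(1) T(1) by (simp add: continuous_on_open_vimage)
  moreover have "0 \<in> e -` T" using e(3) e'(2) T(2) by (metis Int_iff rangeI vimageI2)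
  ultimately obtain \<rho> where \<rho>: "\<rho> > 0" "ball 0 \<rho> \<subseteq> e -` T" using open_contains_ball by blast
  define w where "w = complex_of_real (\<rho> / 2)"
  have w: "w \<noteq> 0" "norm w < \<rho>" using \<rho>(1) by (auto simp: w_def)
  define Z where "Z = {\<zeta>::complex. \<zeta> ^ m = 1}"
  have "\<exists>u. e' u = e (\<zeta> * w)" if "\<zeta> \<in> Z" for \<zeta>
  proof -
    have "\<zeta> * w \<in> ball 0 \<rho> - {0}"
      by (rule unit_root_in_punctured_disc[of _ m]) (use that w e(5) in \<open>auto simp: Z_def\<close>)
    then have "e (\<zeta> * w) \<in> range e'" using \<rho>(2) T(2) e(4) by auto
    then show ?thesis by auto
  qed
  then obtain h where h: "\<And>\<zeta>. \<zeta> \<in> Z \<Longrightarrow> e' (h \<zeta>) = e (\<zeta> * w)" by metis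
  have one: "1 \<in> Z" by (simp add: Z_def)
  have "h 1 \<noteq> 0"
  proof
    assume "h 1 = 0"
    then have "e (1 * w) = e 0" using h[OF one] e(3) e'(2) by simp
    then show False using e(2) w(1) by (simp add: inj_eq)
  qed
  have "card Z \<le> card {z. z ^ n = h 1 ^ n}"
  proof (rule card_inj_on_le)
    show "inj_on h Z"
    proof (rule inj_onI)
      fix \<zeta> \<zeta>' assume "\<zeta> \<in> Z" "\<zeta>' \<in> Z" "h \<zeta> = h \<zeta>'"
      then have "e (\<zeta> * w) = e (\<zeta>' * w)" using h by metis
      then show "\<zeta> = \<zeta>'" using e(2) w(1) by (simp add: inj_eq)
    qed
    show "h ` Z \<subseteq> {z. z ^ n = h 1 ^ n}"
    proof safe
      fix \<zeta> assume \<zeta>: "\<zeta> \<in> Z"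
      have "(\<zeta> * w) ^ m = (1 * w) ^ m" using \<zeta> by (simp add: Z_def power_mult_distrib)
      then have "f (e' (h \<zeta>)) = f (e' (h 1))" using h[OF \<zeta>] h[OF one] e(6) by metis
      then show "h \<zeta> ^ n = h 1 ^ n" using e'(4) by blast
    qed
    show "finite {z. z ^ n = h 1 ^ n}" using e'(3) by (intro finite_nth_roots) auto
  qed
  also have "card {z. z ^ n = h 1 ^ n} = n"
    using \<open>h 1 \<noteq> 0\<close> e'(3) by (intro card_nth_roots) auto
  finally show ?thesis using e(5) by (simp add: Z_def card_roots_unity_eq)
qed

lemma local_degree_eq:
  assumes "has_local_degree Y X f y m"
  shows "local_degree Y X f y = m"
  unfolding local_degree_def
  using assms local_degree_le by (metis (mono_tags, lifting) dual_order.antisym the_equality)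

section \<open>The tetrahedral cover\<close>

definition \<omega> :: complex where "\<omega> = Complex (- 1 / 2) (sqrt 3 / 2)"

lemma \<omega>_eqs: "\<omega>\<^sup>2 = - 1 - \<omega>" "\<omega> * \<omega> = - 1 - \<omega>" "\<omega> ^ 3 = 1"
proof -
  show 1: "\<omega> * \<omega> = - 1 - \<omega>" by (simp add: \<omega>_def complex_eq_iff field_simps)
  then show "\<omega>\<^sup>2 = - 1 - \<omega>" by (simp add: power2_eq_square)
  have "\<omega> ^ 3 = \<omega> * (\<omega> * \<omega>)" by (simp add: power3_eq_cube)
  also have "\<dots> = - \<omega> - \<omega> * \<omega>" unfolding 1 by (simp only: right_diff_distrib mult_minus_right mult_1_right 1)
  also have "\<dots> = 1" unfolding 1 by simp
  finally show "\<omega> ^ 3 = 1" .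
qed

lemma \<omega>_neqs: "\<omega> \<noteq> 0" "\<omega> \<noteq> 1" "\<omega>\<^sup>2 \<noteq> 1" "\<omega>\<^sup>2 \<noteq> \<omega>" "\<omega>\<^sup>2 \<noteq> 0" "1 + \<omega> \<noteq> 0"
  unfolding \<omega>_eqs by (auto simp: \<omega>_def complex_eq_iff)

text \<open>A square root of \<open>- \<omega>\<close>, used to split the quadratic form \<open>x\<^sup>2 + \<omega> * y\<^sup>2\<close> into linear
  factors.\<close>

definition \<kappa> :: complex where "\<kappa> = \<i> * \<omega>\<^sup>2"

lemma \<kappa>_square: "\<kappa>\<^sup>2 = - \<omega>" and \<kappa>_nz: "\<kappa> \<noteq> 0"
proof -
  have "(\<omega>\<^sup>2)\<^sup>2 = \<omega> ^ 3 * \<omega>" by (simp add: power2_eq_square power3_eq_cube mult_ac)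
  then show "\<kappa>\<^sup>2 = - \<omega>" by (simp add: \<kappa>_def power_mult_distrib \<omega>_eqs(3))
  show "\<kappa> \<noteq> 0" using \<omega>_neqs by (simp add: \<kappa>_def)
qed

text \<open>The function \<open>tet\<close> is the quotient map of the sphere by the tetrahedral group, of degree 12 and
  with ramification of orders 3, 3, 2 over 0, infinity and 1. It is the composition of the cube map
  with a quotient by the Klein four-group. The latter is found as follows. If \<open>x\<close> and \<open>y\<close> are square
  roots of \<open>(h - 1) / (h - \<omega>\<^sup>2)\<close> and \<open>(h - \<omega>) / (h - \<omega>\<^sup>2)\<close>, then \<open>x\<^sup>2 + \<omega> * y\<^sup>2 = - \<omega>\<^sup>2\<close>, and
  \<open>z = x + \<kappa> * y\<close> is a coordinate on this conic: its conjugate \<open>x - \<kappa> * y\<close> is \<open>- \<omega>\<^sup>2 / z\<close>, which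
  gives \<open>y\<close> and then \<open>h\<close> as functions of \<open>z\<close>.\<close>

definition tet_y :: "complex \<Rightarrow> complex" where "tet_y z = (z + \<omega>\<^sup>2 / z) / (2 * \<kappa>)"
definition tet_h :: "complex \<Rightarrow> complex" where "tet_h z = (\<omega> - \<omega>\<^sup>2 * (tet_y z)\<^sup>2) / (1 - (tet_y z)\<^sup>2)"
definition tet :: "complex \<Rightarrow> complex" where "tet z = tet_h z ^ 3"
definition tet_dom :: "complex set" where "tet_dom = {z. z \<noteq> 0 \<and> (tet_y z)\<^sup>2 \<noteq> 1}"

text \<open>The two square roots and the formulas for \<open>tet\<close> are inverse to each other; this lemma turns
  roots of a function into a lift through \<open>tet\<close>.\<close>

lemma tet_point:
  assumes h: "h \<noteq> \<omega>\<^sup>2" and x: "x\<^sup>2 = (h - 1) / (h - \<omega>\<^sup>2)" and y: "y\<^sup>2 = (h - \<omega>) / (h - \<omega>\<^sup>2)"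
  shows "x + \<kappa> * y \<in> tet_dom" "tet_y (x + \<kappa> * y) = y" "tet_h (x + \<kappa> * y) = h" "tet (x + \<kappa> * y) = h ^ 3"
proof -
  let ?z = "x + \<kappa> * y"
  have d: "h - \<omega>\<^sup>2 \<noteq> 0" using h by simp
  have X: "x\<^sup>2 * (h - \<omega>\<^sup>2) = h - 1" and Y: "y\<^sup>2 * (h - \<omega>\<^sup>2) = h - \<omega>"
    using x y d by simp_all
  have "(x\<^sup>2 + \<omega> * y\<^sup>2) * (h - \<omega>\<^sup>2) = (h - 1) + \<omega> * (h - \<omega>)"
    unfolding distrib_right mult.assoc X Y ..
  also have "\<dots> = - \<omega>\<^sup>2 * (h - \<omega>\<^sup>2)"
    by (simp add: \<omega>_eqs algebra_simps)
  finally have conic: "x\<^sup>2 + \<omega> * y\<^sup>2 = - \<omega>\<^sup>2" using d mult_right_cancel by blast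
  have prod: "?z * (x - \<kappa> * y) = - \<omega>\<^sup>2"
  proof -
    have "?z * (x - \<kappa> * y) = x\<^sup>2 - \<kappa>\<^sup>2 * y\<^sup>2" by (simp add: algebra_simps power2_eq_square)
    then show ?thesis using conic by (simp add: \<kappa>_square)
  qed
  then have z: "?z \<noteq> 0" using \<omega>_neqs by auto
  have "\<omega>\<^sup>2 / ?z = - (x - \<kappa> * y)"
    using prod z by (simp add: field_simps)
  then show ty: "tet_y ?z = y"
    using \<kappa>_nz by (simp add: tet_y_def)
  have 1: "(1 - y\<^sup>2) * (h - \<omega>\<^sup>2) = \<omega> - \<omega>\<^sup>2"
    unfolding left_diff_distrib Y by simp
  then have y1: "1 - y\<^sup>2 \<noteq> 0" using \<omega>_neqs by auto
  then show "?z \<in> tet_dom" using z ty by (simp add: tet_dom_def)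
  have "(\<omega> - \<omega>\<^sup>2 * y\<^sup>2) * (h - \<omega>\<^sup>2) = h * (1 - y\<^sup>2) * (h - \<omega>\<^sup>2)"
    unfolding mult.assoc 1 left_diff_distrib Y by (simp add: \<omega>_eqs algebra_simps)
  then have "\<omega> - \<omega>\<^sup>2 * y\<^sup>2 = h * (1 - y\<^sup>2)" using d by simp
  then show th: "tet_h ?z = h" unfolding tet_h_def ty using y1 by simp
  then show "tet ?z = h ^ 3" by (simp add: tet_def)
qed

lemma tet_y_from_h:
  assumes "z \<in> tet_dom"
  shows "(tet_y z)\<^sup>2 = (tet_h z - \<omega>) / (tet_h z - \<omega>\<^sup>2)" "tet_h z \<noteq> \<omega>\<^sup>2"
proof -
  let ?s = "(tet_y z)\<^sup>2"
  have s: "1 - ?s \<noteq> 0" using assms by (auto simp: tet_dom_def)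
  have h: "tet_h z * (1 - ?s) = \<omega> - \<omega>\<^sup>2 * ?s" using s by (simp add: tet_h_def)
  have 1: "(tet_h z - \<omega>\<^sup>2) * (1 - ?s) = \<omega> - \<omega>\<^sup>2"
    unfolding left_diff_distrib h by (simp add: algebra_simps)
  have 2: "(tet_h z - \<omega>) * (1 - ?s) = ?s * (\<omega> - \<omega>\<^sup>2)"
    unfolding left_diff_distrib h by (simp add: algebra_simps)
  show nz: "tet_h z \<noteq> \<omega>\<^sup>2" using 1 \<omega>_neqs by auto
  have "(tet_h z - \<omega>) * (1 - ?s) = ?s * (tet_h z - \<omega>\<^sup>2) * (1 - ?s)"
    unfolding mult.assoc 1 2 ..
  then have "tet_h z - \<omega> = ?s * (tet_h z - \<omega>\<^sup>2)" using s mult_right_cancel by blast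
  then show "?s = (tet_h z - \<omega>) / (tet_h z - \<omega>\<^sup>2)" using nz by simp
qed

lemma finite_square_roots: "finite {y::complex. y\<^sup>2 = s}"
  by (intro finite_nth_roots) auto

lemma finite_tet_y_vimage: "finite {z. z \<noteq> 0 \<and> tet_y z = y}"
proof (rule finite_subset)
  show "{z. z \<noteq> 0 \<and> tet_y z = y} \<subseteq> (\<lambda>w. w + \<kappa> * y) ` {w. w\<^sup>2 = \<kappa>\<^sup>2 * y\<^sup>2 - \<omega>\<^sup>2}"
  proof safe
    fix z assume z: "z \<noteq> 0" and y: "y = tet_y z"
    have "2 * \<kappa> * tet_y z = z + \<omega>\<^sup>2 / z" using \<kappa>_nz by (simp add: tet_y_def)
    then have "2 * \<kappa> * tet_y z * z = z\<^sup>2 + \<omega>\<^sup>2" using z by (simp add: field_simps power2_eq_square)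
    then have "(z - \<kappa> * tet_y z)\<^sup>2 = \<kappa>\<^sup>2 * (tet_y z)\<^sup>2 - \<omega>\<^sup>2"
      by (simp add: power2_eq_square algebra_simps)
    then show "z \<in> (\<lambda>w. w + \<kappa> * tet_y z) ` {w. w\<^sup>2 = \<kappa>\<^sup>2 * (tet_y z)\<^sup>2 - \<omega>\<^sup>2}"
      by (intro image_eqI[of _ _ "z - \<kappa> * tet_y z"]) auto
  qed
  show "finite ((\<lambda>w. w + \<kappa> * y) ` {w. w\<^sup>2 = \<kappa>\<^sup>2 * y\<^sup>2 - \<omega>\<^sup>2})"
    by (intro finite_imageI finite_square_roots)
qed

lemma finite_tet_vimage:
  assumes "finite B" shows "finite {z \<in> tet_dom. tet z \<in> B}"
proof (rule finite_subset)
  let ?R = "\<lambda>x. \<Union>h\<in>{h. h ^ 3 = x}. \<Union>y\<in>{y. y\<^sup>2 = (h - \<omega>) / (h - \<omega>\<^sup>2)}. {z. z \<noteq> 0 \<and> tet_y z = y}"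
  show "{z \<in> tet_dom. tet z \<in> B} \<subseteq> (\<Union>x\<in>B. ?R x)"
    using tet_y_from_h by (auto simp: tet_def tet_dom_def)
  show "finite (\<Union>x\<in>B. ?R x)"
    using assms by (intro finite_UN_I finite_square_roots finite_tet_y_vimage finite_nth_roots) auto
qed

lemma finite_not_tet_dom: "finite (- tet_dom)"
proof (rule finite_subset)
  show "- tet_dom \<subseteq> {0} \<union> (\<Union>y\<in>{y. y\<^sup>2 = 1}. {z. z \<noteq> 0 \<and> tet_y z = y})"
    by (auto simp: tet_dom_def)
  show "finite ({0} \<union> (\<Union>y\<in>{y. y\<^sup>2 = 1}. {z. z \<noteq> 0 \<and> tet_y z = y}))"
    by (intro finite_UnI finite_UN_I finite_square_roots finite_tet_y_vimage) auto
qed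

lemma open_tet_dom: "open tet_dom"
  using finite_not_tet_dom by (metis closed_open finite_imp_closed boolean_algebra_class.boolean_algebra.double_compl)

lemma tet_has_derivative:
  assumes "z \<in> tet_dom"
  shows "(tet has_field_derivative
    3 * (tet_h z)\<^sup>2 * ((\<omega> - \<omega>\<^sup>2) / (1 - (tet_y z)\<^sup>2)\<^sup>2 * (2 * tet_y z * ((1 - \<omega>\<^sup>2 / z\<^sup>2) / (2 * \<kappa>))))) (at z)"
proof -
  have z: "z \<noteq> 0" "1 - (tet_y z)\<^sup>2 \<noteq> 0" using assms by (auto simp: tet_dom_def)
  have y: "(tet_y has_field_derivative (1 - \<omega>\<^sup>2 / z\<^sup>2) / (2 * \<kappa>)) (at z)"
    unfolding tet_y_def using z \<kappa>_nz
    by (auto intro!: derivative_eq_intros simp: power2_eq_square field_simps)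
  define M where "M = (\<lambda>s. (\<omega> - \<omega>\<^sup>2 * s) / (1 - s))"
  have M: "(M has_field_derivative (\<omega> - \<omega>\<^sup>2) / (1 - s)\<^sup>2) (at s)" if "1 - s \<noteq> 0" for s
    unfolding M_def using that
    by (auto intro!: derivative_eq_intros simp: power2_eq_square field_simps)
  have "((\<lambda>z. (tet_y z)\<^sup>2) has_field_derivative 2 * tet_y z * ((1 - \<omega>\<^sup>2 / z\<^sup>2) / (2 * \<kappa>))) (at z)"
    by (rule derivative_eq_intros y)+ simp
  from DERIV_chain2[OF M[OF z(2)] this]
  have "(tet_h has_field_derivative (\<omega> - \<omega>\<^sup>2) / (1 - (tet_y z)\<^sup>2)\<^sup>2 * (2 * tet_y z * ((1 - \<omega>\<^sup>2 / z\<^sup>2) / (2 * \<kappa>)))) (at z)"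
    by (simp add: M_def tet_h_def[abs_def])
  from DERIV_power[OF this, of 3] show ?thesis
    by (simp add: tet_def[abs_def] mult_ac)
qed

text \<open>The derivative vanishes only if \<open>tet_h z = 0\<close>, \<open>tet_y z = 0\<close> or \<open>z\<^sup>2 = \<omega>\<^sup>2\<close>, and at such
  points \<open>tet\<close> takes the value 0 or 1.\<close>

lemma tet_locally_injective:
  assumes z: "z \<in> tet_dom" and x: "tet z \<noteq> 0" "tet z \<noteq> 1"
  obtains \<epsilon> where "\<epsilon> > 0" "ball z \<epsilon> \<subseteq> tet_dom" "inj_on tet (ball z \<epsilon>)"
proof -
  have z': "z \<noteq> 0" "1 - (tet_y z)\<^sup>2 \<noteq> 0" using z by (auto simp: tet_dom_def)
  have h: "tet_h z \<noteq> 0" using x(1) by (simp add: tet_def)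
  have y: "tet_y z \<noteq> 0"
  proof
    assume "tet_y z = 0"
    then have "tet z = \<omega> ^ 3" by (simp add: tet_def tet_h_def)
    then show False using x(2) \<omega>_eqs(3) by simp
  qed
  have w: "1 - \<omega>\<^sup>2 / z\<^sup>2 \<noteq> 0"
  proof
    assume "1 - \<omega>\<^sup>2 / z\<^sup>2 = 0"
    then have "z\<^sup>2 = \<omega>\<^sup>2" using z' by (simp add: field_simps)
    then have "\<omega>\<^sup>2 / z = z" using z' by (simp add: field_simps power2_eq_square)
    then have "tet_y z = z / \<kappa>" using \<kappa>_nz by (simp add: tet_y_def)
    then have "(tet_y z)\<^sup>2 = \<omega>\<^sup>2 / - \<omega>" using \<open>z\<^sup>2 = \<omega>\<^sup>2\<close> \<kappa>_square by (simp add: power_divide)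
    then have "(tet_y z)\<^sup>2 = - \<omega>" using \<omega>_neqs by (simp add: power2_eq_square)
    then have "tet_h z = (\<omega> + \<omega> ^ 3) / (1 + \<omega>)"
      by (simp add: tet_h_def power2_eq_square power3_eq_cube)
    then have "tet_h z = 1" using \<omega>_neqs by (simp add: \<omega>_eqs(3) add.commute)
    then show False using x(2) by (simp add: tet_def)
  qed
  have "deriv tet z \<noteq> 0"
    using DERIV_imp_deriv[OF tet_has_derivative[OF z]] z' h y w \<omega>_neqs \<kappa>_nz by simp
  moreover have "tet holomorphic_on tet_dom"
    using tet_has_derivative by (meson holomorphic_onI field_differentiable_at_within field_differentiable_def)
  ultimately obtain r where r: "r > 0" "ball z r \<subseteq> tet_dom" "inj_on tet (ball z r)"
    using has_complex_derivative_locally_injective[OF _ z open_tet_dom] by metis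
  then show thesis using that by blast
qed

text \<open>There are three choices for the cube root and two for each of the square roots.\<close>

lemma tet_has_12_preimages:
  assumes x: "x \<noteq> 0" "x \<noteq> 1"
  obtains Z where "finite Z" "card Z = 12" "Z \<subseteq> tet_dom" "\<And>z. z \<in> Z \<Longrightarrow> tet z = x"
proof -
  define Hs where "Hs = {h::complex. h ^ 3 = x}"
  define Xs where "Xs = (\<lambda>h::complex. {u. u\<^sup>2 = (h - 1) / (h - \<omega>\<^sup>2)})"
  define Ys where "Ys = (\<lambda>h::complex. {u. u\<^sup>2 = (h - \<omega>) / (h - \<omega>\<^sup>2)})"
  have h: "h \<noteq> 1" "h \<noteq> \<omega>" "h \<noteq> \<omega>\<^sup>2" if "h \<in> Hs" for h
  proof -
    have "h ^ 3 \<noteq> 1" using that x by (simp add: Hs_def)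
    moreover have "(\<omega>\<^sup>2) ^ 3 = 1" by (metis \<omega>_eqs(3) power_mult mult.commute power_one)
    ultimately show "h \<noteq> 1" "h \<noteq> \<omega>" "h \<noteq> \<omega>\<^sup>2" using \<omega>_eqs(3) by auto
  qed
  have card: "card Hs = 3" "card (Xs h \<times> Ys h) = 4" if "h \<in> Hs" for h
    using h[OF that] x by (auto simp: Hs_def Xs_def Ys_def card_cartesian_product card_nth_roots)
  have fin: "finite Hs" "finite (Xs h \<times> Ys h)" for h
    by (auto simp: Hs_def Xs_def Ys_def intro!: finite_cartesian_product finite_nth_roots)
  have "Hs \<noteq> {}" using card_nth_roots[OF x(1), of 3] unfolding Hs_def by force
  then have "card Hs = 3" using card by blast
  then have c12: "card (SIGMA h:Hs. Xs h \<times> Ys h) = 12"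
    using card fin by (subst card_SigmaI) auto
  let ?g = "\<lambda>(h::complex, u, v). u + \<kappa> * v"
  have pt: "u + \<kappa> * v \<in> tet_dom \<and> tet_y (u + \<kappa> * v) = v \<and> tet_h (u + \<kappa> * v) = h \<and> tet (u + \<kappa> * v) = x"
    if "h \<in> Hs" "u \<in> Xs h" "v \<in> Ys h" for h u v
    using tet_point[of h u v] h[OF that(1)] that by (simp add: Hs_def Xs_def Ys_def)
  have "inj_on ?g (SIGMA h:Hs. Xs h \<times> Ys h)"
  proof (rule inj_onI)
    fix s s' assume s: "s \<in> (SIGMA h:Hs. Xs h \<times> Ys h)" "s' \<in> (SIGMA h:Hs. Xs h \<times> Ys h)" "?g s = ?g s'"
    obtain h u v where s1: "s = (h, u, v)" by (cases s)
    obtain h' u' v' where s2: "s' = (h', u', v')" by (cases s')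
    have eq: "u + \<kappa> * v = u' + \<kappa> * v'" using s(3) by (simp add: s1 s2)
    have "v = v'" "h = h'"
      using pt[of h u v] pt[of h' u' v'] s(1,2) by (auto simp: s1 s2 eq)
    then show "s = s'" using eq by (simp add: s1 s2)
  qed
  then have "card (?g ` (SIGMA h:Hs. Xs h \<times> Ys h)) = 12"
    using c12 by (simp add: card_image)
  moreover have "finite (?g ` (SIGMA h:Hs. Xs h \<times> Ys h))"
    using fin by (intro finite_imageI finite_SigmaI[of Hs "\<lambda>h. Xs h \<times> Ys h"])
  moreover have "z \<in> tet_dom \<and> tet z = x" if "z \<in> ?g ` (SIGMA h:Hs. Xs h \<times> Ys h)" for z
    using that pt by auto
  ultimately show thesis using that by blast
qed

section \<open>The fibres of a lift\<close>

text \<open>Here \<open>f = p \<circ> g\<close> outside the fibres over \<open>B\<close>. The fibres of \<open>g\<close> all have the same number of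
  points because this number is locally constant on the connected set \<open>G\<close>: the \<open>d\<close> points of a
  fibre of \<open>f\<close> can be followed to a neighbouring fibre since \<open>f\<close> is open, they exhaust it since it
  too has \<open>d\<close> points, and \<open>p\<close> being locally injective, the values of \<open>g\<close> at them are followed along.
  The fibres of \<open>g\<close> over the points of \<open>Z\<close> then partition a subset of one fibre of \<open>f\<close>.\<close>

lemma lift_fibre_bound:
  fixes f :: "'a::metric_space \<Rightarrow> 'b::topological_space" and g :: "'a \<Rightarrow> 'c::metric_space"
  assumes opn: "\<And>y W. openin (top_of_set Y) W \<Longrightarrow> y \<in> W \<Longrightarrow> \<exists>T. openin (top_of_set X) T \<and> f y \<in> T \<and> T \<subseteq> f ` W"
    and deg: "\<And>x. x \<in> X - B \<Longrightarrow> finite {y \<in> Y. f y = x} \<and> card {y \<in> Y. f y = x} = d"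
    and Y0: "openin (top_of_set Y) {y \<in> Y. f y \<notin> B}"
    and G: "connected G" and p: "continuous_on G p" "\<And>z. z \<in> G \<Longrightarrow> p z \<in> X - B"
    and inj: "\<And>z. z \<in> G \<Longrightarrow> \<exists>\<epsilon>>0. inj_on p (ball z \<epsilon> \<inter> G)"
    and g: "continuous_on {y \<in> Y. f y \<notin> B} g"
      "\<And>y. y \<in> Y \<Longrightarrow> f y \<notin> B \<Longrightarrow> g y \<in> G" "\<And>y. y \<in> Y \<Longrightarrow> f y \<notin> B \<Longrightarrow> p (g y) = f y"
    and Z: "finite Z" "Z \<subseteq> G" "\<And>z. z \<in> Z \<Longrightarrow> p z = x" "x \<in> X - B" and z0: "z0 \<in> G"
  shows "card Z * card {y \<in> Y. f y \<notin> B \<and> g y = z0} \<le> d"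
proof -
  let ?N = "\<lambda>z. {y \<in> Y. f y \<notin> B \<and> g y = z}"
  have fib: "{y \<in> Y. f y \<notin> B \<and> g y = z} = {y \<in> Y. f y = p z \<and> g y = z}" if "z \<in> G" for z
  proof (rule Collect_cong)
    fix y
    show "y \<in> Y \<and> f y \<notin> B \<and> g y = z \<longleftrightarrow> y \<in> Y \<and> f y = p z \<and> g y = z"
    proof
      assume "y \<in> Y \<and> f y \<notin> B \<and> g y = z"
      then show "y \<in> Y \<and> f y = p z \<and> g y = z" using g(3)[of y] by simp
    next
      assume "y \<in> Y \<and> f y = p z \<and> g y = z"
      then show "y \<in> Y \<and> f y \<notin> B \<and> g y = z" using p(2)[OF that] by simp
    qed
  qed
  have "(\<lambda>z. card (?N z)) constant_on G"
  proof (rule locally_constant_imp_constant[OF G])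
    let ?Y = "{y \<in> Y. f y \<notin> B}"
    fix u assume u: "u \<in> G"
    define S where "S = {y \<in> Y. f y = p u}"
    have S: "finite S" "card S = d" "S \<subseteq> ?Y" using deg[OF p(2)[OF u]] p(2)[OF u] by (auto simp: S_def)
    obtain \<epsilon> where \<epsilon>: "\<epsilon> > 0" "inj_on p (ball u \<epsilon> \<inter> G)" using inj[OF u] by blast
    obtain \<delta> where \<delta>: "\<delta> > 0" "\<And>y. y \<in> S \<Longrightarrow> g y \<noteq> u \<Longrightarrow> \<delta> \<le> dist u (g y)"
      using finite_set_avoid[of "g ` S" u] S(1) by auto
    \<comment> \<open>half of \<open>\<delta>\<close>, so that two points within \<open>e\<close> of a common point cannot be \<open>\<delta>\<close> apart\<close>
    define e where "e = min \<epsilon> (\<delta> / 2)"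
    have e: "e > 0" using \<epsilon> \<delta> by (simp add: e_def)
    have "\<exists>\<rho>>0. \<forall>y'\<in>S. y' \<noteq> y \<longrightarrow> \<rho> \<le> dist y y'" for y
      using finite_set_avoid[OF S(1)] by blast
    then obtain \<rho> where \<rho>: "\<And>y. \<rho> y > 0" "\<And>y y'. y' \<in> S \<Longrightarrow> y' \<noteq> y \<Longrightarrow> \<rho> y \<le> dist y y'"
      by metis
    define W where "W = (\<lambda>y. (?Y \<inter> g -` ball (g y) e) \<inter> (?Y \<inter> ball y (\<rho> y / 2)))"
    have W_open: "openin (top_of_set Y) (W y)" for y
    proof -
      have "openin (top_of_set Y) (?Y \<inter> g -` ball (g y) e)"
        by (rule openin_trans[OF continuous_openin_preimage_gen[OF g(1)] Y0]) simp
      moreover have "openin (top_of_set Y) (?Y \<inter> ball y (\<rho> y / 2))"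
        using Y0 open_ball by (rule openin_Int_open)
      ultimately show ?thesis unfolding W_def by (rule openin_Int)
    qed
    have yW: "y \<in> W y" if "y \<in> S" for y
      using that S(3) \<rho>(1)[of y] e by (auto simp: W_def)
    have "\<exists>T. openin (top_of_set X) T \<and> f y \<in> T \<and> T \<subseteq> f ` W y" if "y \<in> S" for y
      using opn[OF W_open yW[OF that]] .
    then obtain T where T: "\<And>y. y \<in> S \<Longrightarrow> openin (top_of_set X) (T y)" "\<And>y. y \<in> S \<Longrightarrow> f y \<in> T y"
      "\<And>y. y \<in> S \<Longrightarrow> T y \<subseteq> f ` W y"
      by metis
    define V where "V = X \<inter> (\<Inter>y\<in>S. T y)"
    have V: "openin (top_of_set X) V"
    proof (cases "S = {}")
      case False
      then have "openin (top_of_set X) (\<Inter>y\<in>S. T y)" using T(1) S(1) by (intro openin_INT2) auto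
      then show ?thesis unfolding V_def by (intro openin_Int openin_subtopology_self)
    qed (simp add: V_def)
    have pV: "p u \<in> V" using T(2) p(2)[OF u] by (auto simp: V_def S_def)
    let ?O = "{z \<in> G. p z \<in> V} \<inter> ball u e"
    show "\<exists>T. openin (top_of_set G) T \<and> u \<in> T \<and>
      (\<forall>z\<in>T. card {y \<in> Y. f y \<notin> B \<and> g y = z} = card {y \<in> Y. f y \<notin> B \<and> g y = u})"
    proof (intro exI conjI ballI)
      have "openin (top_of_set G) (G \<inter> p -` V)"
        by (rule continuous_openin_preimage[OF p(1) _ V]) (use p(2) in auto)
      moreover have "G \<inter> p -` V = {z \<in> G. p z \<in> V}" by blast
      ultimately show "openin (top_of_set G) ?O" by (auto intro: openin_Int_open)
      show "u \<in> ?O" using u e pV by auto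
      fix z assume z: "z \<in> ?O"
      then have zG: "z \<in> G" "p z \<in> V" "dist u z < e" by auto
      let ?S = "{y \<in> Y. f y = p z}"
      have "\<exists>s\<in>W y. f s = p z" if "y \<in> S" for y
      proof -
        have "p z \<in> T y" using zG(2) that by (auto simp: V_def)
        then show ?thesis using T(3)[OF that] by (metis imageE subsetD)
      qed
      then obtain s where s: "\<And>y. y \<in> S \<Longrightarrow> s y \<in> W y" "\<And>y. y \<in> S \<Longrightarrow> f (s y) = p z"
        by metis
      have sd: "dist y (s y) < \<rho> y / 2" "s y \<in> Y" "f (s y) \<notin> B" "dist (g y) (g (s y)) < e" if "y \<in> S" for y
        using s(1)[OF that] by (auto simp: W_def)
      have inj_s: "inj_on s S"
      proof (rule inj_onI, rule ccontr)
        fix y y' assume y: "y \<in> S" "y' \<in> S" "s y = s y'" "y \<noteq> y'"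
        have "dist y y' \<le> dist y (s y) + dist y' (s y')" using y(3) dist_triangle2 by metis
        also have "\<dots> < \<rho> y / 2 + \<rho> y' / 2" using sd(1)[OF y(1)] sd(1)[OF y(2)] by (rule add_strict_mono)
        also have "\<dots> \<le> dist y y'" using \<rho>(2)[of y' y] \<rho>(2)[of y y'] y by (simp add: dist_commute)
        finally show False by simp
      qed
      have sS: "s ` S = ?S"
      proof (rule card_subset_eq)
        show "finite ?S" "card (s ` S) = card ?S"
          using deg[OF p(2)[OF zG(1)]] S(2) inj_s by (simp_all add: card_image)
        show "s ` S \<subseteq> ?S" using s(2) sd(2) by auto
      qed
      have gs: "g (s y) = z \<longleftrightarrow> g y = u" if "y \<in> S" for y
      proof
        assume "g (s y) = z"
        then have "dist u (g y) < e + e"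
          using dist_triangle_less_add[of u z e "g y" e] zG(3) sd(4)[OF that] by (simp add: dist_commute)
        then show "g y = u" using \<delta>(2)[OF that] by (force simp: e_def)
      next
        assume "g y = u"
        then have "g (s y) \<in> ball u \<epsilon> \<inter> G" using sd[OF that] g(2) by (auto simp: e_def)
        moreover have "z \<in> ball u \<epsilon> \<inter> G" using zG by (auto simp: e_def)
        moreover have "p (g (s y)) = p z" using g(3) sd[OF that] s(2)[OF that] by simp
        ultimately show "g (s y) = z" using \<epsilon>(2) by (auto dest: inj_onD)
      qed
      have u_fib: "{y \<in> Y. f y \<notin> B \<and> g y = u} = {y \<in> S. g y = u}"
        unfolding fib[OF u] by (auto simp: S_def)
      have "{y \<in> Y. f y \<notin> B \<and> g y = z} = {y \<in> s ` S. g y = z}"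
        unfolding fib[OF zG(1)] sS by auto
      also have "\<dots> = s ` {y \<in> S. g y = u}"
        using gs by (auto simp: image_iff)
      finally have "card {y \<in> Y. f y \<notin> B \<and> g y = z} = card (s ` {y \<in> S. g y = u})" by simp
      also have "\<dots> = card {y \<in> S. g y = u}"
        by (intro card_image inj_on_subset[OF inj_s]) auto
      finally show "card {y \<in> Y. f y \<notin> B \<and> g y = z} = card {y \<in> Y. f y \<notin> B \<and> g y = u}"
        unfolding u_fib .
    qed
  qed
  then obtain c where c: "\<And>z. z \<in> G \<Longrightarrow> card (?N z) = c"
    unfolding constant_on_def by blast
  have const: "card (?N z) = card (?N z0)" if "z \<in> Z" for z
    by (simp only: c[OF z0] c[OF subsetD[OF Z(2) that]])
  have sub: "(\<Union>z\<in>Z. ?N z) \<subseteq> {y \<in> Y. f y = x}"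
  proof
    fix y assume "y \<in> (\<Union>z\<in>Z. ?N z)"
    then have y: "y \<in> Y" "f y \<notin> B" "g y \<in> Z" by auto
    then show "y \<in> {y \<in> Y. f y = x}" using g(3)[OF y(1,2)] Z(3)[OF y(3)] by simp
  qed
  have fin: "finite {y \<in> Y. f y = x}" "card {y \<in> Y. f y = x} = d" using deg[OF Z(4)] by auto
  have "card Z * card (?N z0) = (\<Sum>z\<in>Z. card (?N z0))" by simp
  also have "\<dots> = (\<Sum>z\<in>Z. card (?N z))" by (intro sum.cong refl const[symmetric])
  also have "\<dots> = card (\<Union>z\<in>Z. ?N z)"
  proof (rule card_UN_disjoint[symmetric, OF Z(1)])
    have "finite (\<Union>z\<in>Z. ?N z)" by (rule finite_subset[OF sub fin(1)])
    then show "\<forall>z\<in>Z. finite (?N z)" using Z(1) by (simp only: finite_UN)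
    show "\<forall>z\<in>Z. \<forall>z'\<in>Z. z \<noteq> z' \<longrightarrow> ?N z \<inter> ?N z' = {}" by blast
  qed
  also have "\<dots> \<le> d" using card_mono[OF fin(1) sub] fin(2) by simp
  finally show ?thesis .
qed

section \<open>Extracting roots in charts\<close>

text \<open>Away from the punctures continuity provides the local roots.\<close>

lemma has_root_on_punctured_sphere:
  fixes F :: "real ^ 3 \<Rightarrow> complex"
  assumes cont: "continuous_on (S2 - P) F" and nz: "\<And>y. y \<in> S2 - P \<Longrightarrow> F y \<noteq> 0"
    and P: "finite P" "k > 0"
    and local: "\<And>y. y \<in> S2 \<inter> P \<Longrightarrow> \<exists>W. openin (top_of_set S2) W \<and> y \<in> W \<and> has_root_on k F (W - P)"
  shows "has_root_on k F (S2 - P)"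
proof (rule has_root_on_sphere[OF _ nz P])
  fix y :: "real ^ 3"
  assume y: "y \<in> S2"
  show "\<exists>W. openin (top_of_set S2) W \<and> y \<in> W \<and> has_root_on k F (W - P)"
  proof (cases "y \<in> P")
    case False
    let ?B = "ball (F y) (norm (F y))"
    let ?W = "(S2 - P) \<inter> F -` ?B"
    have "openin (top_of_set S2) (S2 - P)"
      using P(1) by (intro openin_sphere_complement_compact finite_imp_compact)
    then have "openin (top_of_set S2) ?W"
      by (rule openin_trans[OF continuous_openin_preimage_gen[OF cont open_ball]])
    moreover have "y \<in> ?W" using y False nz[of y] by simp
    moreover have "has_root_on k F (?W - P)"
    proof -
      obtain r where r: "continuous_on ?B r" "\<And>z. z \<in> ?B \<Longrightarrow> r z ^ k = z"
        using kth_root_branch_on_ball[OF P(2)] by blast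
      have "continuous_on (?W - P) (\<lambda>u. r (F u))"
        by (rule continuous_on_compose2[OF r(1) continuous_on_subset[OF cont]]) auto
      moreover have "r (F u) ^ k = F u" if "u \<in> ?W - P" for u
        using r(2) that by simp
      ultimately show ?thesis unfolding has_root_on_def by blast
    qed
    ultimately show ?thesis by blast
  qed (use local y in blast)
qed

lemma eventually_at_0_disc:
  fixes Q :: "complex \<Rightarrow> bool"
  shows "eventually Q (at 0) \<longleftrightarrow> (\<exists>\<rho>>0. \<forall>w \<in> ball 0 \<rho> - {0}. Q w)"
  by (simp add: eventually_at Ball_def conj_commute)

text \<open>A parametrised disc around every point of the sphere, and a finite set \<open>P\<close> of punctures.\<close>

locale sphere_charts =
  fixes P :: "(real ^ 3) set" and e :: "real ^ 3 \<Rightarrow> complex \<Rightarrow> real ^ 3"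
  assumes finite_P: "finite P"
    and chart_hom: "\<And>y. y \<in> S2 \<Longrightarrow> \<exists>e'. homeomorphism UNIV (range (e y)) (e y) e'"
    and chart_0: "\<And>y. y \<in> S2 \<Longrightarrow> e y 0 = y"
    and chart_range: "\<And>y. y \<in> S2 \<Longrightarrow> range (e y) \<subseteq> S2"
    and chart_open: "\<And>y V. y \<in> S2 \<Longrightarrow> open V \<Longrightarrow> openin (top_of_set S2) (e y ` V)"
begin

lemma chart_cont: "y \<in> S2 \<Longrightarrow> continuous_on UNIV (e y)"
  using chart_hom by (auto simp: homeomorphism_def)

lemma chart_inj: "y \<in> S2 \<Longrightarrow> inj (e y)"
  using chart_hom[of y] by (auto simp: homeomorphism_def intro: inj_on_inverseI)

lemma eventually_chart_avoids:
  assumes y: "y \<in> S2" and "finite T"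
  shows "\<forall>\<^sub>F w in at 0. e y w \<notin> T"
proof -
  have "finite (e y -` T)" using chart_inj[OF y] assms(2) by (simp add: finite_vimageI)
  then have "\<forall>\<^sub>F w in at 0. w \<notin> e y -` T"
    by (metis eventually_at_topological finite_imp_closed islimpt_finite islimpt_iff_eventually)
  then show ?thesis by simp
qed

text \<open>Near \<open>y\<close> the function depends on the \<open>a\<close>-th power of the chart only.\<close>

definition invariant_at :: "real ^ 3 \<Rightarrow> nat \<Rightarrow> (real ^ 3 \<Rightarrow> complex) \<Rightarrow> bool" where
  "invariant_at y a q \<longleftrightarrow> (\<forall>\<^sub>F w in at 0. \<forall>\<zeta>. \<zeta> ^ a = 1 \<longrightarrow> q (e y (\<zeta> * w)) = q (e y w))"

text \<open>Near \<open>y\<close> the values lie in a ball on which every root has a branch.\<close>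

definition branch_near :: "real ^ 3 \<Rightarrow> (real ^ 3 \<Rightarrow> complex) \<Rightarrow> bool" where
  "branch_near y F \<longleftrightarrow> (\<exists>c. \<forall>\<^sub>F w in at 0. F (e y w) \<in> ball c (norm c))"

lemma branch_near_tendsto:
  assumes "((\<lambda>w. F (e y w)) \<longlongrightarrow> c) (at 0)" "c \<noteq> 0"
  shows "branch_near y F"
  unfolding branch_near_def
proof
  show "\<forall>\<^sub>F w in at 0. F (e y w) \<in> ball c (norm c)"
    using assms by (intro topological_tendstoD) auto
qed

lemma tendsto_chart:
  assumes "y \<in> S2 - P" "continuous_on (S2 - P) q"
  shows "((\<lambda>w. q (e y w)) \<longlongrightarrow> q y) (at 0)"
proof -
  have y: "y \<in> S2" using assms by simp
  have "((\<lambda>w. e y w) \<longlongrightarrow> y) (at 0)"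
    using chart_cont[OF y] chart_0[OF y] by (metis continuous_on_def UNIV_I)
  moreover have "\<forall>\<^sub>F w in at 0. e y w \<in> S2 - P"
    using eventually_chart_avoids[OF y finite_P] by eventually_elim (use chart_range[OF y] in blast)
  ultimately show ?thesis
    using assms by (intro continuous_on_tendsto_compose[OF assms(2)]) auto
qed

lemma invariant_at_comp: "invariant_at y a q \<Longrightarrow> invariant_at y a (\<lambda>u. G (q u))"
  unfolding invariant_at_def by (erule eventually_mono) auto

lemma invariant_at_comp2:
  "invariant_at y a p \<Longrightarrow> invariant_at y a q \<Longrightarrow> invariant_at y a (\<lambda>u. G (p u) (q u))"
  unfolding invariant_at_def by (erule (1) eventually_elim2) auto

text \<open>One step in the construction of the lift. At each point either the function takes values
  where a branch of the root exists, and its symmetry \<open>b y\<close> passes to the root, or it may wind around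
  the origin but has the larger symmetry \<open>k * b y\<close>, of which a factor \<open>k\<close> is used up by the root.\<close>

lemma root_step:
  assumes cont: "continuous_on (S2 - P) F" and nz: "\<And>y. y \<in> S2 - P \<Longrightarrow> F y \<noteq> 0" and k: "k > 0"
    and b: "\<And>y. y \<in> S2 \<Longrightarrow> b y > 0"
    and local: "\<And>y. y \<in> S2 \<Longrightarrow>
      (branch_near y F \<and> invariant_at y (b y) F) \<or> invariant_at y (k * b y) F"
  obtains q where "continuous_on (S2 - P) q" "\<And>y. y \<in> S2 - P \<Longrightarrow> q y ^ k = F y"
    "\<And>y. y \<in> S2 \<Longrightarrow> invariant_at y (b y) q"
proof -
  have disc: "\<exists>\<rho>>0. (\<forall>w\<in>ball 0 \<rho> - {0}. e y w \<in> S2 - P) \<and>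
      ((\<exists>c. (\<forall>w\<in>ball 0 \<rho> - {0}. F (e y w) \<in> ball c (norm c)) \<and>
          invariant_under_unit_roots \<rho> (b y) (\<lambda>w. F (e y w))) \<or>
        invariant_under_unit_roots \<rho> (k * b y) (\<lambda>w. F (e y w)))" if y: "y \<in> S2" for y
  proof -
    have av: "\<forall>\<^sub>F w in at 0. e y w \<in> S2 - P"
      using eventually_chart_avoids[OF y finite_P] by eventually_elim (use chart_range[OF y] in blast)
    from local[OF y] show ?thesis
    proof
      assume "branch_near y F \<and> invariant_at y (b y) F"
      then obtain c where "\<forall>\<^sub>F w in at 0. F (e y w) \<in> ball c (norm c)"
        "\<forall>\<^sub>F w in at 0. \<forall>\<zeta>. \<zeta> ^ b y = 1 \<longrightarrow> F (e y (\<zeta> * w)) = F (e y w)"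
        unfolding branch_near_def invariant_at_def by blast
      with av have "\<forall>\<^sub>F w in at 0. e y w \<in> S2 - P \<and> F (e y w) \<in> ball c (norm c) \<and>
          (\<forall>\<zeta>. \<zeta> ^ b y = 1 \<longrightarrow> F (e y (\<zeta> * w)) = F (e y w))"
        by (intro eventually_conj)
      then show ?thesis
        unfolding eventually_at_0_disc invariant_under_unit_roots_def by blast
    next
      assume "invariant_at y (k * b y) F"
      with av have "\<forall>\<^sub>F w in at 0. e y w \<in> S2 - P \<and>
          (\<forall>\<zeta>. \<zeta> ^ (k * b y) = 1 \<longrightarrow> F (e y (\<zeta> * w)) = F (e y w))"
        unfolding invariant_at_def by (rule eventually_conj)
      then show ?thesis
        unfolding eventually_at_0_disc invariant_under_unit_roots_def by blast
    qed
  qed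
  have contF: "continuous_on (ball 0 \<rho> - {0}) (\<lambda>w. Q (e y w))"
    if "y \<in> S2" "\<forall>w\<in>ball 0 \<rho> - {0}. e y w \<in> S2 - P" "continuous_on (S2 - P) Q" for y \<rho> and Q :: "real ^ 3 \<Rightarrow> complex"
    by (rule continuous_on_compose2[OF that(3) continuous_on_subset[OF chart_cont[OF that(1)]]])
       (use that(2) in auto)
  have "has_root_on k F (S2 - P)"
  proof (rule has_root_on_punctured_sphere[OF cont nz finite_P k])
    fix y assume yP: "y \<in> S2 \<inter> P"
    then have y: "y \<in> S2" by simp
    obtain \<rho> where \<rho>: "\<rho> > 0" and av: "\<forall>w\<in>ball 0 \<rho> - {0}. e y w \<in> S2 - P"
      and alt: "(\<exists>c. (\<forall>w\<in>ball 0 \<rho> - {0}. F (e y w) \<in> ball c (norm c)) \<and>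
          invariant_under_unit_roots \<rho> (b y) (\<lambda>w. F (e y w))) \<or>
        invariant_under_unit_roots \<rho> (k * b y) (\<lambda>w. F (e y w))"
      using disc[OF y] by blast
    let ?D = "ball (0::complex) \<rho> - {0}"
    note cFe = contF[OF y av cont]
    have "\<exists>q. continuous_on ?D q \<and> (\<forall>w\<in>?D. q w ^ k = F (e y w))"
      using alt
    proof (elim disjE exE conjE)
      fix c assume c: "\<forall>w\<in>?D. F (e y w) \<in> ball c (norm c)"
      obtain r where r: "continuous_on (ball c (norm c)) r" "\<And>z. z \<in> ball c (norm c) \<Longrightarrow> r z ^ k = z"
        using kth_root_branch_on_ball[OF k] by blast
      have "continuous_on ?D (\<lambda>w. r (F (e y w)))"
        by (rule continuous_on_compose2[OF r(1) cFe]) (use c in blast)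
      then show ?thesis using r(2) c by blast
    next
      assume "invariant_under_unit_roots \<rho> (k * b y) (\<lambda>w. F (e y w))"
      then have "invariant_under_unit_roots \<rho> k (\<lambda>w. F (e y w))"
        by (simp add: invariant_under_unit_roots_def power_mult)
      from invariant_has_root[OF this cFe _ k \<rho>] show ?thesis
        using nz av by (metis (no_types, lifting))
    qed
    then obtain q where q: "continuous_on ?D q" "\<And>w. w \<in> ?D \<Longrightarrow> q w ^ k = F (e y w)" by blast
    obtain e' where e': "homeomorphism UNIV (range (e y)) (e y) e'" using chart_hom[OF y] by blast
    then have e'1: "continuous_on (range (e y)) e'" "\<And>w. e' (e y w) = w"
      by (auto simp: homeomorphism_def)
    have WP: "e y ` ball 0 \<rho> - P = e y ` ?D"
      using av chart_0[OF y] yP \<rho> by auto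
    have "continuous_on (e y ` ?D) (\<lambda>u. q (e' u))"
      by (rule continuous_on_compose2[OF q(1) continuous_on_subset[OF e'1(1)]]) (auto simp: e'1(2))
    then have "has_root_on k F (e y ` ?D)"
      unfolding has_root_on_def using q(2) e'1(2) by (intro exI[of _ "\<lambda>u. q (e' u)"]) auto
    then show "\<exists>W. openin (top_of_set S2) W \<and> y \<in> W \<and> has_root_on k F (W - P)"
      using chart_open[OF y, of "ball 0 \<rho>"] chart_0[OF y] \<rho> WP
      by (intro exI[of _ "e y ` ball 0 \<rho>"]) (auto simp: image_iff intro!: bexI[of _ 0])
  qed
  then obtain q where q: "continuous_on (S2 - P) q" "\<And>y. y \<in> S2 - P \<Longrightarrow> q y ^ k = F y"
    unfolding has_root_on_def by blast
  have "invariant_at y (b y) q" if y: "y \<in> S2" for y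
  proof -
    obtain \<rho> where \<rho>: "\<rho> > 0" and av: "\<forall>w\<in>ball 0 \<rho> - {0}. e y w \<in> S2 - P"
      and alt: "(\<exists>c. (\<forall>w\<in>ball 0 \<rho> - {0}. F (e y w) \<in> ball c (norm c)) \<and>
          invariant_under_unit_roots \<rho> (b y) (\<lambda>w. F (e y w))) \<or>
        invariant_under_unit_roots \<rho> (k * b y) (\<lambda>w. F (e y w))"
      using disc[OF y] by blast
    let ?D = "ball (0::complex) \<rho> - {0}"
    note cFe = contF[OF y av cont] and cqe = contF[OF y av q(1)]
    have pow: "q (e y w) ^ k = F (e y w)" if "w \<in> ?D" for w
      using q(2) av that by blast
    from alt have "invariant_under_unit_roots \<rho> (b y) (\<lambda>w. q (e y w))"
    proof (elim disjE exE conjE)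
      fix c assume c: "\<forall>w\<in>?D. F (e y w) \<in> ball c (norm c)"
        "invariant_under_unit_roots \<rho> (b y) (\<lambda>w. F (e y w))"
      show ?thesis
        by (rule root_of_invariant_near[OF c(2) cFe cqe pow _ k b[OF y]]) (use c(1) in blast)+
    next
      assume inv: "invariant_under_unit_roots \<rho> (k * b y) (\<lambda>w. F (e y w))"
      show ?thesis
        by (rule root_of_invariant_far[OF inv cqe pow _ k b[OF y]]) (use nz av in blast)+
    qed
    then show ?thesis
      using \<rho> unfolding invariant_at_def eventually_at_0_disc invariant_under_unit_roots_def by blast
  qed
  with q show thesis using that by blast
qed

end

section \<open>Lifting through the tetrahedral cover\<close>

text \<open>The analogue of a Moebius transformation that moves three given points to 0, infinity and 1.\<close>

lemma sphere_coordinate: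
  fixes x1 x2 x3 :: "real ^ 3"
  assumes "x1 \<in> S2" "x2 \<in> S2" "x3 \<in> S2" "x1 \<noteq> x2" "x3 \<noteq> x2" "x1 \<noteq> x3"
  obtains \<theta> \<theta>' where "homeomorphism (S2 - {x2}) (UNIV :: complex set) \<theta> \<theta>'" "\<theta> x1 = 0" "\<theta> x3 = 1"
proof -
  obtain \<sigma> \<tau> where \<sigma>: "homeomorphism (S2 - {x2}) (UNIV :: complex set) \<sigma> \<tau>"
    using sphere_minus_point_plane[OF assms(2)] by blast
  then have "\<tau> (\<sigma> x1) = x1" "\<tau> (\<sigma> x3) = x3" using assms by (auto simp: homeomorphism_def)
  then have d: "\<sigma> x3 - \<sigma> x1 \<noteq> 0" using \<open>x1 \<noteq> x3\<close> by auto
  have "homeomorphism (UNIV :: complex set) UNIV (\<lambda>z. (z - \<sigma> x1) / (\<sigma> x3 - \<sigma> x1)) (\<lambda>z. \<sigma> x1 + z * (\<sigma> x3 - \<sigma> x1))"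
    by (rule homeomorphismI) (use d in \<open>auto intro!: continuous_intros\<close>)
  from homeomorphism_compose[OF \<sigma> this] show thesis
    by (rule that) (use d in auto)
qed

lemma tendsto_0_of_power:
  fixes h :: "'a \<Rightarrow> complex"
  assumes "((\<lambda>w. h w ^ k) \<longlongrightarrow> 0) F" "k > 0"
  shows "(h \<longlongrightarrow> 0) F"
proof -
  have "((\<lambda>w. norm (h w) ^ k) \<longlongrightarrow> 0) F"
    using tendsto_norm_zero[OF assms(1)] by (simp add: norm_power)
  then have "((\<lambda>w. norm (h w)) \<longlongrightarrow> 0) F" using assms(2) by simp
  then show ?thesis by (rule tendsto_norm_zero_cancel)
qed

text \<open>The order of the cone point \<open>x\<close> in the sphere with cone points of orders 3, 3 and 2.\<close>

definition orbifold_order :: "'a \<Rightarrow> 'a \<Rightarrow> 'a \<Rightarrow> 'a \<Rightarrow> nat" where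
  "orbifold_order x1 x2 x3 x = (if x = x1 \<or> x = x2 then 3 else if x = x3 then 2 else 1)"

text \<open>A cube root of the coordinate function \<open>F\<close> and two square roots combine to a lift \<open>g\<close> through \<open>tet\<close> that, near
  \<open>y\<close>, depends only on the \<open>a\<close>-th power of the chart, where \<open>a\<close> is the local degree divided by the
  order of the cone point. Hence some fibre of \<open>g\<close> has at least \<open>a\<close> points, while twelve times the
  size of a fibre is at most \<open>d\<close>.\<close>

theorem tetrahedral_bound:
  fixes f :: "real ^ 3 \<Rightarrow> real ^ 3"
  assumes cover: "branched_cover S2 S2 f" and degree: "has_degree S2 S2 f d"
    and B: "finite B" "B \<subseteq> S2" "branch_points S2 S2 f \<subseteq> B" "\<And>x. x \<in> B \<Longrightarrow> finite {y \<in> S2. f y = x}"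
    and x: "x1 \<in> B" "x2 \<in> B" "x3 \<in> B" "x1 \<noteq> x2" "x3 \<noteq> x2" "x1 \<noteq> x3"
    and dvd: "\<And>y. y \<in> S2 \<Longrightarrow> orbifold_order x1 x2 x3 (f y) dvd local_degree S2 S2 f y"
    and y0: "y0 \<in> S2"
  shows "12 * (local_degree S2 S2 f y0 div orbifold_order x1 x2 x3 (f y0)) \<le> d"
proof -
  let ?ord = "orbifold_order x1 x2 x3"
  define m where "m = local_degree S2 S2 f"
  define a where "a = (\<lambda>y. m y div ?ord (f y))"
  have fS: "f y \<in> S2" if "y \<in> S2" for y
    using cover that unfolding branched_cover_def by blast
  have contf: "continuous_on S2 f" using cover by (simp add: branched_cover_def)
  have ld: "has_local_degree S2 S2 f y (m y)" if "y \<in> S2" for y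
    using cover that local_degree_eq unfolding branched_cover_def m_def by metis
  have ma: "m y = ?ord (f y) * a y" if "y \<in> S2" for y
    using dvd[OF that] by (simp add: a_def m_def)
  define C where "C = (\<lambda>y (e :: complex \<Rightarrow> real ^ 3). (\<exists>e'. homeomorphism UNIV (range e) e e') \<and> e 0 = y \<and> range e \<subseteq> S2 \<and>
    m y > 0 \<and> (\<forall>w w'. f (e w) = f (e w') \<longleftrightarrow> w ^ m y = w' ^ m y) \<and>
    (\<forall>V. open V \<longrightarrow> openin (top_of_set S2) (e ` V)) \<and>
    (\<forall>V. open V \<longrightarrow> 0 \<in> V \<longrightarrow> (\<exists>T. openin (top_of_set S2) T \<and> f y \<in> T \<and> T \<subseteq> f ` e ` V)))"
  have "\<exists>e. C y e" if "y \<in> S2" for y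
    unfolding C_def by (rule local_degree_chart[OF ld[OF that]]) blast
  then obtain e where e: "\<And>y. y \<in> S2 \<Longrightarrow> C y (e y)" by metis
  note eC = e[unfolded C_def]
  note e_hom = eC[THEN conjunct1]
    and e_0 = eC[THEN conjunct2, THEN conjunct1]
    and e_range = eC[THEN conjunct2, THEN conjunct2, THEN conjunct1]
    and mpos = eC[THEN conjunct2, THEN conjunct2, THEN conjunct2, THEN conjunct1]
    and fe = eC[THEN conjunct2, THEN conjunct2, THEN conjunct2, THEN conjunct2, THEN conjunct1, rule_format]
    and e_open = eC[THEN conjunct2, THEN conjunct2, THEN conjunct2, THEN conjunct2, THEN conjunct2, THEN conjunct1, rule_format]
    and f_open = eC[THEN conjunct2, THEN conjunct2, THEN conjunct2, THEN conjunct2, THEN conjunct2, THEN conjunct2, rule_format]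
  have apos: "a y > 0" if "y \<in> S2" for y
    using ma[OF that] mpos[OF that] by (cases "a y") auto
  define P where "P = {y \<in> S2. f y \<in> {x1, x2, x3}}"
  define PB where "PB = {y \<in> S2. f y \<in> B}"
  have "PB = (\<Union>x\<in>B. {y \<in> S2. f y = x})" by (auto simp: PB_def)
  then have finPB: "finite PB" using B(1,4) by simp
  have PPB: "P \<subseteq> PB" using x by (auto simp: P_def PB_def)
  interpret sphere_charts P e
  proof
    show "finite P" using finite_subset[OF PPB finPB] .
  qed (fact e_hom e_0 e_range e_open)+
  have eS: "e y w \<in> S2" if "y \<in> S2" for y w using chart_range[OF that] by blast
  \<comment> \<open>in the coordinate \<open>\<theta>\<close> on the target the cone points are 0, infinity and 1, as for \<open>tet\<close>\<close>
  have xS: "x1 \<in> S2" "x2 \<in> S2" "x3 \<in> S2" using x B by auto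
  obtain \<theta> \<theta>' where \<theta>: "homeomorphism (S2 - {x2}) (UNIV :: complex set) \<theta> \<theta>'" "\<theta> x1 = 0" "\<theta> x3 = 1"
    using sphere_coordinate[OF xS x(4,5,6)] by blast
  have \<theta>c: "continuous_on (S2 - {x2}) \<theta>" "continuous_on UNIV \<theta>'" "range \<theta>' = S2 - {x2}"
    and \<theta>i: "\<And>u. u \<in> S2 - {x2} \<Longrightarrow> \<theta>' (\<theta> u) = u" "\<And>z. \<theta> (\<theta>' z) = z"
    using \<theta>(1) by (auto simp: homeomorphism_def)
  define F where "F = (\<lambda>y. \<theta> (f y))"
  have contF: "continuous_on (S2 - P) F"
    unfolding F_def
    by (rule continuous_on_compose2[OF \<theta>c(1) continuous_on_subset[OF contf]]) (use fS in \<open>auto simp: P_def\<close>)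
  have F01: "F y \<noteq> 0" "F y \<noteq> 1" if "y \<in> S2 - P" for y
  proof -
    have "f y \<in> S2 - {x2}" "f y \<noteq> x1" "f y \<noteq> x3" using that fS by (auto simp: P_def)
    then show "F y \<noteq> 0" "F y \<noteq> 1"
      using \<theta>i(1)[of "f y"] \<theta>i(1)[of x1] \<theta>i(1)[of x3] \<theta>(2,3) xS x unfolding F_def by auto
  qed
  have invF: "invariant_at y (m y) F" if "y \<in> S2" for y
  proof -
    have "F (e y (\<zeta> * w)) = F (e y w)" if "\<zeta> ^ m y = 1" for \<zeta> w
      using fe[OF \<open>y \<in> S2\<close>, of "\<zeta> * w" w] that by (simp add: F_def power_mult_distrib)
    then show ?thesis unfolding invariant_at_def by simp
  qed
  have limf: "((\<lambda>w. f (e y w)) \<longlongrightarrow> f y) (at 0)" if y: "y \<in> S2" for y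
  proof -
    have "continuous_on UNIV (\<lambda>w. f (e y w))"
      by (rule continuous_on_compose2[OF contf chart_cont[OF y]]) (use chart_range[OF y] in blast)
    then show ?thesis using chart_0[OF y] by (metis continuous_on_def UNIV_I)
  qed
  have limF: "((\<lambda>w. F (e y w)) \<longlongrightarrow> \<theta> (f y)) (at 0)" if y: "y \<in> S2" "f y \<noteq> x2" for y
  proof -
    have "\<forall>\<^sub>F w in at 0. f (e y w) \<in> S2 - {x2}"
      using eventually_chart_avoids[OF y(1) finite_P]
    proof eventually_elim
      case (elim w)
      then show ?case using eS[OF y(1), of w] fS[of "e y w"] by (auto simp: P_def)
    qed
    then show ?thesis
      unfolding F_def using fS y by (intro continuous_on_tendsto_compose[OF \<theta>c(1) limf]) auto
  qed
  have infF: "filterlim (\<lambda>w. F (e y w)) at_infinity (at 0)" if y: "y \<in> S2" "f y = x2" for y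
    unfolding filterlim_at_infinity[OF order.refl]
  proof (intro allI impI)
    fix r :: real
    have "openin (top_of_set S2) (S2 - \<theta>' ` cball 0 r)"
      by (intro openin_sphere_complement_compact compact_continuous_image continuous_on_subset[OF \<theta>c(2)]) auto
    then obtain T where T: "open T" "S2 - \<theta>' ` cball 0 r = S2 \<inter> T" by (auto simp: openin_open)
    have "x2 \<notin> \<theta>' ` cball 0 r" using \<theta>c(3) by auto
    then have "f y \<in> T" using T(2) xS(2) y(2) by auto
    then have "\<forall>\<^sub>F w in at 0. f (e y w) \<in> T" using limf[OF y(1)] T(1) by (auto intro: topological_tendstoD)
    moreover have "\<forall>\<^sub>F w in at 0. e y w \<notin> P" by (rule eventually_chart_avoids[OF y(1) finite_P])
    ultimately show "\<forall>\<^sub>F w in at 0. r \<le> norm (F (e y w))"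
    proof eventually_elim
      case (elim w)
      have 1: "f (e y w) \<in> S2" using fS eS y by blast
      then have "f (e y w) \<notin> \<theta>' ` cball 0 r" using elim(1) T(2) by blast
      moreover have "\<theta>' (F (e y w)) = f (e y w)"
        using 1 elim(2) eS[OF y(1), of w] \<theta>i(1) by (auto simp: F_def P_def)
      ultimately show ?case by (metis imageI less_eq_real_def linorder_not_le mem_cball_0)
    qed
  qed
  \<comment> \<open>Over \<open>x1\<close> and \<open>x2\<close> the factor 3 of the local degree is spent on the cube root \<open>h\<close>; over \<open>x3\<close>,
      where \<open>F\<close> is close to 1, the factor 2 is kept for the square roots.\<close>
  obtain h where h: "continuous_on (S2 - P) h" "\<And>y. y \<in> S2 - P \<Longrightarrow> h y ^ 3 = F y"
    and invh: "\<And>y. y \<in> S2 \<Longrightarrow> invariant_at y (if f y = x3 then 2 * a y else a y) h"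
  proof (rule root_step[OF contF F01(1), where k = 3 and b = "\<lambda>y. if f y = x3 then 2 * a y else a y"])
    fix y assume y: "y \<in> S2"
    consider "f y = x1 \<or> f y = x2" | "f y = x3" | "y \<notin> P" using y by (auto simp: P_def)
    then show "(branch_near y F \<and> invariant_at y (if f y = x3 then 2 * a y else a y) F) \<or>
      invariant_at y (3 * (if f y = x3 then 2 * a y else a y)) F"
    proof cases
      case 1
      then have "m y = 3 * a y" "f y \<noteq> x3" using ma[OF y] x by (auto simp: orbifold_order_def)
      then show ?thesis using invF[OF y] by simp
    next
      case 2
      then have "m y = 2 * a y" using ma[OF y] x by (auto simp: orbifold_order_def)
      moreover have "branch_near y F"
        using branch_near_tendsto[OF limF[OF y]] 2 x \<theta>(3) by auto
      ultimately show ?thesis using invF[OF y] 2 by simp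
    next
      case 3
      then have f: "f y \<noteq> x1" "f y \<noteq> x2" "f y \<noteq> x3" using y by (auto simp: P_def)
      then have "m y = a y" using ma[OF y] by (simp add: orbifold_order_def)
      moreover have "branch_near y F"
        using branch_near_tendsto[OF limF[OF y f(2)]] F01(1)[of y] y 3 by (simp add: F_def)
      ultimately show ?thesis using invF[OF y] f by simp
    qed
  qed (use apos in auto)
  have h_nz: "h y \<noteq> \<alpha>" if "y \<in> S2 - P" "\<alpha> ^ 3 = 1" for y \<alpha>
    using h(2)[OF that(1)] F01(2)[OF that(1)] that(2) by auto
  \<comment> \<open>The ratio of \<open>h - \<alpha>\<close> and \<open>h - \<beta>\<close> can wind around the origin only over \<open>x3\<close>: it tends to
      \<open>\<alpha> / \<beta>\<close> at the zeros of \<open>h\<close> and to 1 at its poles.\<close>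
  have square_root: "\<exists>q. continuous_on (S2 - P) q \<and> (\<forall>y\<in>S2 - P. (q y)\<^sup>2 = (h y - \<alpha>) / (h y - \<beta>)) \<and>
      (\<forall>y\<in>S2. invariant_at y (a y) q)" if \<alpha>\<beta>: "\<alpha> ^ 3 = 1" "\<beta> ^ 3 = 1" for \<alpha> \<beta>
  proof -
    define u where "u = (\<lambda>y. (h y - \<alpha>) / (h y - \<beta>))"
    have \<alpha>\<beta>0: "\<alpha> \<noteq> 0" "\<beta> \<noteq> 0" using \<alpha>\<beta> by auto
    have contu: "continuous_on (S2 - P) u"
      unfolding u_def using h_nz \<alpha>\<beta> by (intro continuous_intros h(1)) auto
    have u_nz: "u y \<noteq> 0" if "y \<in> S2 - P" for y
      using h_nz[OF that] \<alpha>\<beta> by (simp add: u_def)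
    have invu: "invariant_at y (if f y = x3 then 2 * a y else a y) u" if "y \<in> S2" for y
      unfolding u_def by (rule invariant_at_comp[OF invh[OF that]])
    have hF: "\<forall>\<^sub>F w in at 0. h (e y w) ^ 3 = F (e y w) \<and> e y w \<in> S2 - P" if "y \<in> S2" for y
      using eventually_chart_avoids[OF that finite_P]
      by eventually_elim (use eS[OF that] h(2) in blast)
    show ?thesis
    proof (rule root_step[OF contu u_nz, where k = 2 and b = a])
      fix y assume y: "y \<in> S2"
      consider "f y = x1" | "f y = x2" | "f y = x3" | "y \<notin> P" using y by (auto simp: P_def)
      then show "(branch_near y u \<and> invariant_at y (a y) u) \<or> invariant_at y (2 * a y) u"
      proof cases
        case 1
        have "((\<lambda>w. h (e y w) ^ 3) \<longlongrightarrow> 0) (at 0)"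
          by (rule Lim_transform_eventually[OF limF[OF y, unfolded 1 \<theta>(2)]])
             (use hF[OF y] x in \<open>auto elim: eventually_mono\<close>)
        then have "((\<lambda>w. h (e y w)) \<longlongrightarrow> 0) (at 0)" by (rule tendsto_0_of_power) simp
        then have "((\<lambda>w. u (e y w)) \<longlongrightarrow> (0 - \<alpha>) / (0 - \<beta>)) (at 0)"
          unfolding u_def using \<alpha>\<beta>0 by (intro tendsto_intros) auto
        then have "branch_near y u" by (rule branch_near_tendsto) (use \<alpha>\<beta>0 in simp)
        then show ?thesis using invu[OF y] 1 x by simp
      next
        case 2
        have "((\<lambda>w. inverse (F (e y w))) \<longlongrightarrow> 0) (at 0)"
          by (rule filterlim_compose[OF tendsto_inverse_0 infF[OF y 2]])
        then have "((\<lambda>w. inverse (h (e y w)) ^ 3) \<longlongrightarrow> 0) (at 0)"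
          by (rule Lim_transform_eventually)
             (use hF[OF y] in \<open>auto elim!: eventually_mono simp: power_inverse\<close>)
        then have "((\<lambda>w. inverse (h (e y w))) \<longlongrightarrow> 0) (at 0)" by (rule tendsto_0_of_power) simp
        then have "((\<lambda>w. (1 - \<alpha> * inverse (h (e y w))) / (1 - \<beta> * inverse (h (e y w)))) \<longlongrightarrow>
            (1 - \<alpha> * 0) / (1 - \<beta> * 0)) (at 0)"
          by (intro tendsto_intros) auto
        then have "((\<lambda>w. u (e y w)) \<longlongrightarrow> (1 - \<alpha> * 0) / (1 - \<beta> * 0)) (at 0)"
        proof (rule Lim_transform_eventually)
          show "\<forall>\<^sub>F w in at 0. (1 - \<alpha> * inverse (h (e y w))) / (1 - \<beta> * inverse (h (e y w))) = u (e y w)"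
            using hF[OF y]
          proof eventually_elim
            case (elim w)
            then have 0: "h (e y w) \<noteq> 0" using F01(1)[of "e y w"] by auto
            then have "1 - c * inverse (h (e y w)) = (h (e y w) - c) / h (e y w)" for c
              by (simp add: field_simps)
            then show ?case using 0 by (simp add: u_def)
          qed
        qed
        then have "branch_near y u" by (rule branch_near_tendsto) simp
        then show ?thesis using invu[OF y] 2 x by simp
      next
        case 3
        then show ?thesis using invu[OF y] by simp
      next
        case 4
        then have yP: "y \<in> S2 - P" using y by simp
        have "branch_near y u"
          by (rule branch_near_tendsto[OF tendsto_chart[OF yP contu] u_nz[OF yP]])
        then show ?thesis using invu[OF y] 4 y by (auto simp: P_def)
      qed
    qed (use apos in \<open>auto simp: u_def\<close>)
  qed
  have \<omega>6: "(\<omega>\<^sup>2) ^ 3 = 1" by (metis \<omega>_eqs(3) power_mult mult.commute power_one)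
  obtain X where X: "continuous_on (S2 - P) X" "\<And>y. y \<in> S2 - P \<Longrightarrow> (X y)\<^sup>2 = (h y - 1) / (h y - \<omega>\<^sup>2)"
    "\<And>y. y \<in> S2 \<Longrightarrow> invariant_at y (a y) X"
    using square_root[of 1 "\<omega>\<^sup>2"] \<omega>6 by auto
  obtain Y where Y: "continuous_on (S2 - P) Y" "\<And>y. y \<in> S2 - P \<Longrightarrow> (Y y)\<^sup>2 = (h y - \<omega>) / (h y - \<omega>\<^sup>2)"
    "\<And>y. y \<in> S2 \<Longrightarrow> invariant_at y (a y) Y"
    using square_root[of \<omega> "\<omega>\<^sup>2"] \<omega>6 \<omega>_eqs(3) by auto
  define g where "g = (\<lambda>y. X y + \<kappa> * Y y)"
  have contg: "continuous_on (S2 - P) g" unfolding g_def by (intro continuous_intros X(1) Y(1))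
  have invg: "invariant_at y (a y) g" if "y \<in> S2" for y
    unfolding g_def by (rule invariant_at_comp2[OF X(3)[OF that] Y(3)[OF that]])
  have g: "g y \<in> tet_dom" "tet (g y) = F y" if "y \<in> S2 - P" for y
    using tet_point[OF h_nz[OF that \<omega>6] X(2)[OF that] Y(2)[OF that]] h(2)[OF that] by (simp_all add: g_def)
  \<comment> \<open>\<open>p\<close> is the tetrahedral cover of the sphere, restricted to the part \<open>G\<close> over the complement of \<open>B\<close>\<close>
  define G where "G = {z \<in> tet_dom. tet z \<notin> \<theta> ` (B - {x2})}"
  define p where "p = (\<lambda>z. \<theta>' (tet z))"
  have \<theta>_notin: "\<theta> x \<notin> \<theta> ` (B - {x2})" if "x \<in> S2 - B" for x
  proof
    assume "\<theta> x \<in> \<theta> ` (B - {x2})"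
    then obtain b where b: "b \<in> B" "b \<noteq> x2" "\<theta> x = \<theta> b" by auto
    have "x \<in> S2 - {x2}" "b \<in> S2 - {x2}" using that x(2) b B(2) by auto
    then have "x = b" using b(3) \<theta>i(1) by metis
    then show False using b(1) that by simp
  qed
  have "finite (- G)"
  proof (rule finite_subset)
    show "- G \<subseteq> - tet_dom \<union> {z \<in> tet_dom. tet z \<in> \<theta> ` (B - {x2})}" by (auto simp: G_def)
    show "finite (- tet_dom \<union> {z \<in> tet_dom. tet z \<in> \<theta> ` (B - {x2})})"
      using B(1) by (intro finite_UnI finite_not_tet_dom finite_tet_vimage) simp
  qed
  then have "connected (UNIV - (- G))"
    by (intro connected_open_diff_countable countable_finite) auto
  then have connG: "connected G" by (simp add: Diff_eq)
  have pG: "p z \<in> S2 - B" if "z \<in> G" for z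
  proof -
    have "p z \<in> S2 - {x2}" using \<theta>c(3) unfolding p_def by blast
    moreover have "\<theta> (p z) = tet z" using \<theta>i(2) by (simp add: p_def)
    ultimately show ?thesis using that unfolding G_def by (metis (no_types, lifting) DiffE DiffI image_eqI mem_Collect_eq)
  qed
  have contp: "continuous_on G p"
    unfolding p_def
  proof (rule continuous_on_compose2[OF \<theta>c(2)])
    show "continuous_on G tet"
      using DERIV_isCont[OF tet_has_derivative]
      by (intro continuous_at_imp_continuous_on) (auto simp: G_def)
  qed auto
  have injp: "\<exists>\<epsilon>>0. inj_on p (ball z \<epsilon> \<inter> G)" if "z \<in> G" for z
  proof -
    have "\<theta> x1 \<in> \<theta> ` (B - {x2})" "\<theta> x3 \<in> \<theta> ` (B - {x2})"
      using x by blast+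
    then have "z \<in> tet_dom" "tet z \<noteq> 0" "tet z \<noteq> 1" using that unfolding \<theta>(2,3) by (auto simp: G_def)
    then obtain \<epsilon> where \<epsilon>: "\<epsilon> > 0" "inj_on tet (ball z \<epsilon>)" by (rule tet_locally_injective)
    have "inj_on p (ball z \<epsilon>)"
    proof (rule inj_onI)
      fix u v assume "u \<in> ball z \<epsilon>" "v \<in> ball z \<epsilon>" "p u = p v"
      moreover have "tet u = tet v" using \<open>p u = p v\<close> \<theta>i(2) unfolding p_def by metis
      ultimately show "u = v" using \<epsilon>(2) by (auto dest: inj_onD)
    qed
    then show ?thesis using \<epsilon>(1) by (meson inj_on_subset Int_lower1)
  qed
  have Y0: "{y \<in> S2. f y \<notin> B} = S2 - PB" by (auto simp: PB_def)
  have Y0_open: "openin (top_of_set S2) {y \<in> S2. f y \<notin> B}"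
    unfolding Y0 by (rule openin_sphere_complement_compact[OF finite_imp_compact[OF finPB]])
  have contg': "continuous_on {y \<in> S2. f y \<notin> B} g"
    unfolding Y0 by (rule continuous_on_subset[OF contg]) (use PPB in blast)
  have Y0P: "y \<in> S2 - P" if "y \<in> S2" "f y \<notin> B" for y
    using that PPB by (auto simp: PB_def)
  have gG: "g y \<in> G" if "y \<in> S2" "f y \<notin> B" for y
    using g[OF Y0P[OF that]] \<theta>_notin[of "f y"] fS[OF that(1)] that(2) by (simp add: G_def F_def)
  have pg: "p (g y) = f y" if "y \<in> S2" "f y \<notin> B" for y
  proof -
    have "p (g y) = \<theta>' (\<theta> (f y))" using g(2)[OF Y0P[OF that]] by (simp add: p_def F_def)
    also have "\<dots> = f y" using fS[OF that(1)] that(2) x(2) by (intro \<theta>i(1)) auto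
    finally show ?thesis .
  qed
  have opn: "\<exists>T. openin (top_of_set S2) T \<and> f y \<in> T \<and> T \<subseteq> f ` W"
    if W: "openin (top_of_set S2) W" "y \<in> W" for y W
  proof -
    obtain T where T: "open T" "W = S2 \<inter> T" using W(1) by (auto simp: openin_open)
    have y: "y \<in> S2" using W T by blast
    have "open (e y -` T)" using chart_cont[OF y] T(1) by (simp add: continuous_on_open_vimage)
    moreover have "0 \<in> e y -` T" using e_0[OF y] W(2) T(2) by simp
    ultimately obtain T' where T': "openin (top_of_set S2) T'" "f y \<in> T'" "T' \<subseteq> f ` e y ` (e y -` T)"
      using f_open[OF y] by blast
    have "e y ` (e y -` T) \<subseteq> W" using eS[OF y] T(2) by blast
    then show ?thesis using T' by (meson image_mono order_trans)
  qed
  have deg: "finite {y \<in> S2. f y = x} \<and> card {y \<in> S2. f y = x} = d" if "x \<in> S2 - B" for x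
    using degree B(3) that unfolding has_degree_def by blast
  \<comment> \<open>\<open>w\<close> parametrises a generic point near \<open>y0\<close>; its \<open>a y0\<close> rotations lie in one fibre of \<open>g\<close>\<close>
  have "\<forall>\<^sub>F w in at 0. w \<noteq> 0 \<and> e y0 w \<notin> PB \<and> (\<forall>\<zeta>. \<zeta> ^ a y0 = 1 \<longrightarrow> g (e y0 (\<zeta> * w)) = g (e y0 w))"
    using invg[OF y0] unfolding invariant_at_def
    by (intro eventually_conj eventually_neq_at_within eventually_chart_avoids[OF y0 finPB])
  then obtain w where w: "w \<noteq> 0" "e y0 w \<notin> PB"
    and gw: "\<And>\<zeta>. \<zeta> ^ a y0 = 1 \<Longrightarrow> g (e y0 (\<zeta> * w)) = g (e y0 w)"
    using eventually_happens'[OF at_neq_bot] by blast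
  define v where "v = f (e y0 w)"
  have vB: "v \<notin> B" using w(2) eS[OF y0, of w] by (simp add: v_def PB_def)
  then have v: "v \<in> S2 - B" using fS[OF eS[OF y0]] by (simp add: v_def)
  have v01: "\<theta> v \<noteq> 0" "\<theta> v \<noteq> 1"
    using F01[OF Y0P[OF eS[OF y0], of w]] vB by (simp_all add: F_def v_def)
  obtain Z where Z: "finite Z" "card Z = 12" "Z \<subseteq> tet_dom" "\<And>z. z \<in> Z \<Longrightarrow> tet z = \<theta> v"
    using tet_has_12_preimages[OF v01] by blast
  have ZG: "Z \<subseteq> G" using Z(3,4) \<theta>_notin[OF v] by (auto simp: G_def)
  have pZ: "p z = v" if "z \<in> Z" for z
    using Z(4)[OF that] \<theta>i(1)[of v] v x(2) by (auto simp: p_def)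
  let ?N = "{y \<in> S2. f y \<notin> B \<and> g y = g (e y0 w)}"
  have "card Z * card ?N \<le> d"
    by (rule lift_fibre_bound[OF opn deg Y0_open connG contp pG injp contg' gG pg Z(1) ZG pZ v gG])
       (use eS[OF y0] vB in \<open>auto simp: v_def\<close>)
  moreover have "a y0 \<le> card ?N"
  proof -
    have "card ((\<lambda>\<zeta>. e y0 (\<zeta> * w)) ` {\<zeta>. \<zeta> ^ a y0 = 1}) = card {\<zeta>::complex. \<zeta> ^ a y0 = 1}"
      by (intro card_image inj_onI) (use chart_inj[OF y0] w(1) in \<open>auto simp: inj_eq\<close>)
    also have "\<dots> = a y0" by (rule card_roots_unity_eq[OF apos[OF y0]])
    finally have "card ((\<lambda>\<zeta>. e y0 (\<zeta> * w)) ` {\<zeta>. \<zeta> ^ a y0 = 1}) = a y0" .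
    moreover have "card ((\<lambda>\<zeta>. e y0 (\<zeta> * w)) ` {\<zeta>. \<zeta> ^ a y0 = 1}) \<le> card ?N"
    proof (rule card_mono)
      have "f y = v" if "y \<in> S2" "f y \<notin> B" "g y = g (e y0 w)" for y
        using pg[OF that(1,2)] pg[OF eS[OF y0], of w] vB that(3) by (simp add: v_def)
      then have "?N \<subseteq> {y \<in> S2. f y = v}" by blast
      then show "finite ?N" using deg[OF v] finite_subset by blast
      show "(\<lambda>\<zeta>. e y0 (\<zeta> * w)) ` {\<zeta>. \<zeta> ^ a y0 = 1} \<subseteq> ?N"
      proof
        fix y assume "y \<in> (\<lambda>\<zeta>. e y0 (\<zeta> * w)) ` {\<zeta>. \<zeta> ^ a y0 = 1}"
        then obtain \<zeta> where \<zeta>: "\<zeta> ^ a y0 = 1" "y = e y0 (\<zeta> * w)" by blast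
        have "\<zeta> ^ m y0 = 1" by (simp add: ma[OF y0] mult.commute power_mult \<zeta>(1))
        then have "f y = v" unfolding \<zeta>(2) v_def fe[OF y0] by (simp add: power_mult_distrib)
        then show "y \<in> ?N" using gw[OF \<zeta>(1)] eS[OF y0, of "\<zeta> * w"] vB \<zeta>(2) by simp
      qed
    qed
    ultimately show ?thesis by simp
  qed
  ultimately have "12 * a y0 \<le> d" unfolding Z(2) by (meson dual_order.trans mult_le_mono2)
  then show ?thesis by (simp add: a_def m_def)
qed

section \<open>Branching data\<close>

lemma image_mset_set_eq_imp_bij_betw:
  assumes "finite S" "finite T" "image_mset f (mset_set S) = image_mset g (mset_set T)"
  obtains \<beta> where "bij_betw \<beta> T S" "\<And>t. t \<in> T \<Longrightarrow> f (\<beta> t) = g t"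
proof -
  have "\<exists>\<beta>. bij_betw \<beta> T S \<and> (\<forall>t\<in>T. f (\<beta> t) = g t)"
    using assms(2,1,3)
  proof (induction T arbitrary: S rule: finite_induct)
    case empty
    then have "S = {}" by (simp add: mset_set_empty_iff)
    then show ?case by (simp add: bij_betw_def)
  next
    case (insert t T)
    have "g t \<in># image_mset g (mset_set (insert t T))" using insert.hyps(1) by simp
    then have "g t \<in> f ` S" unfolding insert.prems(2)[symmetric] using insert.prems(1) by simp
    then obtain s where s: "s \<in> S" "f s = g t" by force
    have "image_mset f (mset_set (S - {s})) = image_mset g (mset_set T)"
      using insert.prems s insert.hyps by (simp add: mset_set.remove[of S s])
    then obtain \<beta> where \<beta>: "bij_betw \<beta> T (S - {s})" "\<forall>u\<in>T. f (\<beta> u) = g u"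
      using insert.IH[of "S - {s}"] insert.prems by auto
    let ?\<beta> = "\<beta>(t := s)"
    have "bij_betw ?\<beta> T (S - {s})"
      using \<beta>(1) insert.hyps(2) by (subst bij_betw_cong[of _ _ \<beta>]) auto
    then have "bij_betw ?\<beta> (T \<union> {t}) (S - {s} \<union> {?\<beta> t})"
      using insert.hyps(2) by (subst notIn_Un_bij_betw3[symmetric]) auto
    moreover have "S - {s} \<union> {?\<beta> t} = S" using s by auto
    ultimately have "bij_betw ?\<beta> (insert t T) S" by simp
    moreover have "\<forall>u\<in>insert t T. f (?\<beta> u) = g u" using \<beta>(2) s by auto
    ultimately show ?case by blast
  qed
  then show thesis using that by blast
qed

text \<open>Part (2) follows from part (1). If \<open>r i \<le> 12\<close> for some \<open>i \<ge> 4\<close>, then the obvious bounds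
  \<open>d'\<close>, \<open>d'\<close>, \<open>3 * d' / 2\<close> and \<open>3 * d'\<close> for the other lengths contradict the formula for the sum of
  all lengths, unless \<open>d' = 4\<close>. But then all \<open>a i j\<close> are 1 by part (1), and \<open>A i\<close> is trivial.\<close>

theorem corollary1p3:
  fixes d' n :: nat
    and r :: "nat \<Rightarrow> nat"
    and a :: "nat \<Rightarrow> nat \<Rightarrow> nat"
    and A :: "nat \<Rightarrow> nat multiset"
  assumes "d' \<ge> 4" and "n \<ge> 3" and "4 dvd d'"
    and "\<forall>k\<in>{1..n}. nontrivial_partition (3 * d') (A k)"
    and "\<forall>k\<in>{1..n}. \<forall>l\<in>{1..r k}. a k l \<ge> 1"
    and "A 1 = image_mset (\<lambda>l. 3 * a 1 l) (mset_set {1..r 1})"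
    and "A 2 = image_mset (\<lambda>l. 3 * a 2 l) (mset_set {1..r 2})"
    and "A 3 = image_mset (\<lambda>l. 2 * a 3 l) (mset_set {1..r 3})"
    and "\<forall>k\<in>{4..n}. A k = image_mset (\<lambda>l. a k l) (mset_set {1..r k})"
    and "(\<Sum>k=1..n. r k) = 3 * (n - 2) * d' + 2"
    and "\<exists>f. branched_cover S2 S2 f \<and> has_degree S2 S2 f (3 * d') \<and>
           branching_data S2 S2 f = image_mset A (mset_set {1..n})"
  shows "(\<forall>i\<in>{1..n}. \<forall>j\<in>{1..r i}. real (a i j) \<le> real d' / 4) \<and>
         (n \<ge> 4 \<longrightarrow> (\<forall>i\<in>{4..n}. r i > 12))"
proof -
  obtain f where f: "branched_cover S2 S2 f" "has_degree S2 S2 f (3 * d')"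
    "branching_data S2 S2 f = image_mset A (mset_set {1..n})"
    using assms(11) by blast
  define c :: "nat \<Rightarrow> nat" where "c k = (if k = 1 \<or> k = 2 then 3 else if k = 3 then 2 else 1)" for k
  have A: "A k = image_mset (\<lambda>l. c k * a k l) (mset_set {1..r k})" if "k \<in> {1..n}" for k
  proof -
    have "k = 1 \<or> k = 2 \<or> k = 3 \<or> k \<in> {4..n}" using that by auto
    then show ?thesis using assms(6-9) by (auto simp: c_def)
  qed
  have nontriv: "nontrivial_partition (3 * d') (A k)" if "k \<in> {1..n}" for k
    using assms(4) that by blast
  have mem_A: "b \<in># A k \<longleftrightarrow> (\<exists>l\<in>{1..r k}. b = c k * a k l)" if "k \<in> {1..n}" for b k
    unfolding A[OF that] by auto
  have sum_A: "(\<Sum>l=1..r k. c k * a k l) = 3 * d'" if "k \<in> {1..n}" for k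
  proof -
    have "sum_mset (A k) = 3 * d'"
      using nontriv[OF that] unfolding nontrivial_partition_def is_partition_def by blast
    then show ?thesis unfolding A[OF that] sum_unfold_sum_mset .
  qed
  let ?BP = "branch_points S2 S2 f" and ?ld = "local_degree S2 S2 f"
  have bd: "image_mset (fibre_partition S2 S2 f) (mset_set ?BP) = image_mset A (mset_set {1..n})"
    using f(3) by (simp add: branching_data_def)
  have finBP: "finite ?BP"
  proof (rule ccontr)
    assume "infinite ?BP"
    then show False using bd assms(2) by (simp add: mset_set_empty_iff)
  qed
  obtain \<beta> where \<beta>: "bij_betw \<beta> {1..n} ?BP" "\<And>k. k \<in> {1..n} \<Longrightarrow> fibre_partition S2 S2 f (\<beta> k) = A k"
    using image_mset_set_eq_imp_bij_betw[OF finBP _ bd] by auto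
  have \<beta>_inj: "\<beta> k = \<beta> l \<longleftrightarrow> k = l" if "k \<in> {1..n}" "l \<in> {1..n}" for k l
    using bij_betw_imp_inj_on[OF \<beta>(1)] that by (auto dest: inj_onD)
  have \<beta>_mem: "\<beta> k \<in> ?BP" if "k \<in> {1..n}" for k
    using bij_betwE[OF \<beta>(1)] that by blast
  have fibre: "finite {y \<in> S2. f y = \<beta> k}" if "k \<in> {1..n}" for k
  proof (rule ccontr)
    assume "infinite {y \<in> S2. f y = \<beta> k}"
    then have "mset_set {y \<in> S2. f y = \<beta> k} = {#}" by (rule mset_set.infinite)
    then have "A k = {#}"
      unfolding \<beta>(2)[OF that, symmetric] fibre_partition_def by (simp only: image_mset_empty)
    then show False using nontriv[OF that] by (simp add: nontrivial_partition_def)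
  qed
  have degrees: "b \<in># A k \<longleftrightarrow> (\<exists>y\<in>S2. f y = \<beta> k \<and> b = ?ld y)" if "k \<in> {1..n}" for b k
  proof -
    have "set_mset (A k) = ?ld ` {y \<in> S2. f y = \<beta> k}"
      unfolding \<beta>(2)[OF that, symmetric] fibre_partition_def
      by (simp only: set_image_mset finite_set_mset_mset_set[OF fibre[OF that]])
    then show ?thesis by blast
  qed
  have n123: "1 \<in> {1..n}" "2 \<in> {1..n}" "3 \<in> {1..n}" using assms(2) by auto
  have ord: "orbifold_order (\<beta> 1) (\<beta> 2) (\<beta> 3) (\<beta> k) = c k" if "k \<in> {1..n}" for k
    using \<beta>_inj[OF that n123(1)] \<beta>_inj[OF that n123(2)] \<beta>_inj[OF that n123(3)]
    by (simp add: orbifold_order_def c_def)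
  have dvd: "orbifold_order (\<beta> 1) (\<beta> 2) (\<beta> 3) (f y) dvd ?ld y" if y: "y \<in> S2" for y
  proof (cases "f y \<in> ?BP")
    case True
    then obtain k where k: "k \<in> {1..n}" "f y = \<beta> k"
      using bij_betw_imp_surj_on[OF \<beta>(1)] by blast
    then have "?ld y \<in># A k" using degrees y by blast
    then show ?thesis using mem_A[OF k(1)] ord[OF k(1)] k(2) by auto
  next
    case False
    then show ?thesis using \<beta>_mem n123 by (auto simp: orbifold_order_def)
  qed
  have BP_sub: "?BP \<subseteq> S2"
    unfolding branch_points_def by (rule Collect_restrict)
  have BP_fibre: "finite {y \<in> S2. f y = x}" if x: "x \<in> ?BP" for x
  proof -
    obtain k where "k \<in> {1..n}" "x = \<beta> k"
      using x bij_betw_imp_surj_on[OF \<beta>(1)] by blast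
    then show ?thesis using fibre by simp
  qed
  have \<beta>_neq: "\<beta> 1 \<noteq> \<beta> 2" "\<beta> 3 \<noteq> \<beta> 2" "\<beta> 1 \<noteq> \<beta> 3"
    using \<beta>_inj n123 by simp_all
  have bound: "4 * a k l \<le> d'" if k: "k \<in> {1..n}" and l: "l \<in> {1..r k}" for k l
  proof -
    have "c k * a k l \<in># A k" using mem_A[OF k] l by blast
    then obtain y where y: "y \<in> S2" "f y = \<beta> k" "c k * a k l = ?ld y" using degrees[OF k] by blast
    have "12 * (?ld y div orbifold_order (\<beta> 1) (\<beta> 2) (\<beta> 3) (f y)) \<le> 3 * d'"
      by (rule tetrahedral_bound[OF f(1,2) finBP BP_sub order.refl BP_fibre \<beta>_mem[OF n123(1)]
            \<beta>_mem[OF n123(2)] \<beta>_mem[OF n123(3)] \<beta>_neq dvd y(1)])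
    moreover have "c k > 0" by (simp add: c_def)
    ultimately show ?thesis unfolding y(2) ord[OF k] y(3)[symmetric] by simp
  qed
  have "r i > 12" if i: "i \<in> {4..n}" for i
  proof (rule ccontr)
    assume r: "\<not> r i > 12"
    have i': "i \<in> {1..n}" using i by auto
    have len: "c k * r k \<le> 3 * d'" if "k \<in> {1..n}" for k
    proof -
      have "(\<Sum>l=1..r k. c k) \<le> (\<Sum>l=1..r k. c k * a k l)"
      proof (rule sum_mono)
        fix l assume "l \<in> {1..r k}"
        then have "1 \<le> a k l" using assms(5) that by blast
        then show "c k \<le> c k * a k l" by simp
      qed
      then show ?thesis using sum_A[OF that] by (simp add: mult.commute)
    qed
    obtain m where m: "n = m + 4" using i by (metis atLeastAtMost_iff le_Suc_ex add.commute order_trans)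
    have "(\<Sum>k\<in>{4..n}. r k) = r i + (\<Sum>k\<in>{4..n} - {i}. r k)"
      using i by (simp add: sum.remove)
    also have "(\<Sum>k\<in>{4..n} - {i}. r k) \<le> (\<Sum>k\<in>{4..n} - {i}. 3 * d')"
    proof (rule sum_mono)
      fix k assume "k \<in> {4..n} - {i}"
      then show "r k \<le> 3 * d'" using len[of k] by (simp add: c_def)
    qed
    also have "\<dots> = 3 * d' * m" using i m by (simp add: card_Diff_singleton)
    finally have "(\<Sum>k\<in>{4..n}. r k) \<le> 12 + 3 * d' * m" using r by simp
    moreover have "(\<Sum>k=1..n. r k) = r 1 + r 2 + r 3 + (\<Sum>k\<in>{4..n}. r k)"
    proof -
      have "{1..n} = {1, 2, 3} \<union> {4..n}" using m by auto
      then have "(\<Sum>k=1..n. r k) = (\<Sum>k\<in>{1, 2, 3}. r k) + (\<Sum>k\<in>{4..n}. r k)"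
        by (simp only:) (rule sum.union_disjoint; simp)
      then show ?thesis by simp
    qed
    moreover have "3 * r 1 \<le> 3 * d'" "3 * r 2 \<le> 3 * d'" "2 * r 3 \<le> 3 * d'"
      using len[of 1] len[of 2] len[of 3] n123 by (simp_all add: c_def)
    moreover have "(\<Sum>k=1..n. r k) = 3 * d' * m + 6 * d' + 2"
      using assms(10) m by (simp add: algebra_simps)
    ultimately have "d' \<le> 4" by linarith
    obtain b where b: "b \<in># A i" "b > 1"
      using nontriv[OF i'] unfolding nontrivial_partition_def by blast
    then obtain l where l: "l \<in> {1..r i}" "b = a i l"
      using mem_A[OF i'] i by (auto simp: c_def)
    show False using bound[OF i' l(1)] b(2) l(2) \<open>d' \<le> 4\<close> by simp
  qed
  moreover have "real (a i j) \<le> real d' / 4" if "i \<in> {1..n}" "j \<in> {1..r i}" for i j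
    using bound[OF that] by linarith
  ultimately show ?thesis by blast
qed

end
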